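(* Let $n\ge 4$ and let $D_n$ be the tree with vertices $c,u,v,w_1,\dots,w_{n-3}$ and edges $\{c,u\},\{c,v\},\{c,w_1\},\{w_1,w_2\},\dots,\{w_{n-4},w_{n-3}\}$ (viewed on a vertex set identified with $[n]$). Then the two-sided ideal of relations among the edge generators of $\mathcal E_{D_n}$ (the kernel of the map from the free algebra on symbols $X_e$, one per edge $e$, sending $X_e$ to the corresponding $x_{ij}$) is generated by: the quadratic relations $X_e^2$ for each edge $e$ and $X_eX_f-X_fX_e$ for disjoint edges $e,f$; the braid relations $X_{ja}X_{jb}X_{ja}+X_{jb}X_{ja}X_{jb}$ for each pair of edges $\{j,a\},\{j,b\}$ sharing the vertex $j$; and the claw relations $X_{ja}X_{jb}X_{jc'}X_{ja}+X_{jb}X_{jc'}X_{ja}X_{jb}+X_{jc'}X_{ja}X_{jb}X_{jc'}$ for each triple of edges $\{j,a\},\{j,b\},\{j,c'\}$ sharing the vertex $j$, where $X_{ja}$ denotes the symbol mapping to $x_{ja}$. Moreover $$\mathcal H_{D_n}(t)=[n][n-1]\cdot[4][6][8]\cdots[2n-4].$$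
   Context: Let $n\ge 1$. The Fomin–Kirillov algebra $\mathcal E_n$ is the associative $\mathbb Q$-algebra with generators $x_{ij}$ for ordered pairs of distinct $i,j\in[n]$, subject to $x_{ij}=-x_{ji}$, $x_{ij}^2=0$, $x_{ij}x_{kl}=x_{kl}x_{ij}$ for distinct $i,j,k,l$, and $x_{ij}x_{jk}+x_{jk}x_{ki}+x_{ki}x_{ij}=0$ for distinct $i,j,k$. It is graded by degree. For a simple graph $G$ on vertex set $[n]$, $\mathcal E_G$ is the subalgebra of $\mathcal E_n$ generated by the $x_{ij}$ with $\{i,j\}$ an edge of $G$; $\mathcal H_G(t)=\sum_d\dim\mathcal E_G^d\,t^d$, and $[k]=1+t+\cdots+t^{k-1}$. *)

theory Defs
  imports "HOL-Library.Function_Algebras" "HOL-Computational_Algebra.Polynomial"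
begin

text \<open>An element of the free algebra over Q on an alphabet of type 'a is a
  finitely supported function from words to rationals.  Addition, negation and
  zero are pointwise (Function_Algebras); the algebra product is concatenation.\<close>

type_synonym 'a nc = "'a list \<Rightarrow> rat"

definition falg :: "'a set \<Rightarrow> 'a nc set" where
  "falg A = {p. finite {w. p w \<noteq> 0} \<and> (\<forall>w. p w \<noteq> 0 \<longrightarrow> set w \<subseteq> A)}"

definition nc_scale :: "rat \<Rightarrow> 'a nc \<Rightarrow> 'a nc" where
  "nc_scale c p = (\<lambda>w. c * p w)"

definition nc_word :: "'a list \<Rightarrow> 'a nc" where
  "nc_word u = (\<lambda>w. if w = u then 1 else 0)"

definition nc_gen :: "'a \<Rightarrow> 'a nc" where
  "nc_gen a = nc_word [a]"

definition ncmul :: "'a nc \<Rightarrow> 'a nc \<Rightarrow> 'a nc" where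
  "ncmul p q = (\<lambda>w. \<Sum>i\<le>length w. p (take i w) * q (drop i w))"

definition ncprod :: "'a nc list \<Rightarrow> 'a nc" where
  "ncprod ps = foldr ncmul ps (nc_word [])"

definition nc_map :: "('a \<Rightarrow> 'b) \<Rightarrow> 'a nc \<Rightarrow> 'b nc" where
  "nc_map f p = (\<lambda>v. \<Sum>w\<in>{w. map f w = v \<and> p w \<noteq> 0}. p w)"

inductive_set ideal_gen :: "'a set \<Rightarrow> 'a nc set \<Rightarrow> 'a nc set" for A R where
  zero: "0 \<in> ideal_gen A R"
| base: "r \<in> R \<Longrightarrow> r \<in> ideal_gen A R"
| add: "p \<in> ideal_gen A R \<Longrightarrow> q \<in> ideal_gen A R \<Longrightarrow> p + q \<in> ideal_gen A R"
| lmul: "p \<in> ideal_gen A R \<Longrightarrow> q \<in> falg A \<Longrightarrow> ncmul q p \<in> ideal_gen A R"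
| rmul: "p \<in> ideal_gen A R \<Longrightarrow> q \<in> falg A \<Longrightarrow> ncmul p q \<in> ideal_gen A R"

section \<open>Fomin--Kirillov algebra E_n = free algebra on x_ij modulo fk_ideal n\<close>

definition fk_gens :: "nat \<Rightarrow> (nat \<times> nat) set" where
  "fk_gens n = {(i, j). i \<in> {1..n} \<and> j \<in> {1..n} \<and> i \<noteq> j}"

definition fk_rels :: "nat \<Rightarrow> (nat \<times> nat) nc set" where
  "fk_rels n =
     {nc_gen (i, j) + nc_gen (j, i) | i j. i \<in> {1..n} \<and> j \<in> {1..n} \<and> i \<noteq> j}
   \<union> {ncmul (nc_gen (i, j)) (nc_gen (i, j)) | i j. i \<in> {1..n} \<and> j \<in> {1..n} \<and> i \<noteq> j}
   \<union> {ncmul (nc_gen (i, j)) (nc_gen (k, l)) - ncmul (nc_gen (k, l)) (nc_gen (i, j)) | i j k l.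
        i \<in> {1..n} \<and> j \<in> {1..n} \<and> k \<in> {1..n} \<and> l \<in> {1..n} \<and> distinct [i, j, k, l]}
   \<union> {ncmul (nc_gen (i, j)) (nc_gen (j, k)) + ncmul (nc_gen (j, k)) (nc_gen (k, i))
        + ncmul (nc_gen (k, i)) (nc_gen (i, j)) | i j k.
        i \<in> {1..n} \<and> j \<in> {1..n} \<and> k \<in> {1..n} \<and> distinct [i, j, k]}"

definition fk_ideal :: "nat \<Rightarrow> (nat \<times> nat) nc set" where
  "fk_ideal n = ideal_gen (fk_gens n) (fk_rels n)"

text \<open>A simple graph on [n] is given by its edge set E, a set of 2-element
  subsets of {1..n}.  The symbol X_e (e an edge) is sent to x_ij with
  i = Min e < j = Max e.\<close>

definition edge_gen :: "nat set \<Rightarrow> nat \<times> nat" where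
  "edge_gen e = (Min e, Max e)"

definition fk_kernel :: "nat \<Rightarrow> nat set set \<Rightarrow> nat set nc set" where
  "fk_kernel n E = {p \<in> falg E. nc_map edge_gen p \<in> fk_ideal n}"

text \<open>X_ja: the (signed) element of the free algebra mapping to x_ja.\<close>
definition Xs :: "nat \<Rightarrow> nat \<Rightarrow> nat set nc" where
  "Xs j a = (if j < a then nc_gen {j, a} else - nc_gen {j, a})"

definition graph_rels :: "nat set set \<Rightarrow> nat set nc set" where
  "graph_rels E =
     {ncmul (nc_gen e) (nc_gen e) | e. e \<in> E}
   \<union> {ncmul (nc_gen e) (nc_gen f) - ncmul (nc_gen f) (nc_gen e) | e f.
        e \<in> E \<and> f \<in> E \<and> e \<inter> f = {}}
   \<union> {ncprod [Xs j a, Xs j b, Xs j a] + ncprod [Xs j b, Xs j a, Xs j b] | j a b.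
        {j, a} \<in> E \<and> {j, b} \<in> E \<and> a \<noteq> b}
   \<union> {ncprod [Xs j a, Xs j b, Xs j c, Xs j a] + ncprod [Xs j b, Xs j c, Xs j a, Xs j b]
        + ncprod [Xs j c, Xs j a, Xs j b, Xs j c] | j a b c.
        {j, a} \<in> E \<and> {j, b} \<in> E \<and> {j, c} \<in> E \<and> distinct [a, b, c]}"

abbreviation nc_span :: "'a nc set \<Rightarrow> 'a nc set" where
  "nc_span \<equiv> module.span nc_scale"

abbreviation nc_dim :: "'a nc set \<Rightarrow> nat" where
  "nc_dim \<equiv> vector_space.dim nc_scale"

text \<open>Degree d part of the subalgebra of E_n generated by the x_e, e an edge:
  W_d = span of the degree-d words in the edge generators (in the free algebra);
  its image in E_n = free/fk_ideal has dimension dim W_d - dim (W_d \<inter> ideal).\<close>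
definition EG_words :: "nat set set \<Rightarrow> nat \<Rightarrow> (nat \<times> nat) nc set" where
  "EG_words E d = nc_span {nc_word (map edge_gen w) | w. set w \<subseteq> E \<and> length w = d}"

definition EG_dim :: "nat \<Rightarrow> nat set set \<Rightarrow> nat \<Rightarrow> nat" where
  "EG_dim n E d = nc_dim (EG_words E d) - nc_dim (EG_words E d \<inter> fk_ideal n)"

definition hilbert_coeff :: "nat \<Rightarrow> nat set set \<Rightarrow> nat \<Rightarrow> nat" where
  "hilbert_coeff n E d = EG_dim n E d"

definition qint :: "nat \<Rightarrow> nat poly" where
  "qint k = (\<Sum>i<k. monom 1 i)"

text \<open>The tree D_n: c = 1, u = 2, v = 3, w_i = i + 3 (i = 1..n-3).\<close>
definition Dn_edges :: "nat \<Rightarrow> nat set set" where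
  "Dn_edges n = {{1, 2}, {1, 3}, {1, 4}} \<union> {{k, k + 1} | k. 4 \<le> k \<and> k + 1 \<le> n}"

end

theory Submission
  imports Defs
begin

text \<open>
  Let the letter k = 2, ..., n stand for the edge joining k to its parent in the tree. Upper bound:
  modulo the graph relations, the algebra of the tree on m vertices is spanned, as a left module over
  the algebra of the tree on m - 1 vertices, by the 2 m words

    m (m-1) ... k,   m ... 4 followed by one of 2, 3, 23, 32, 232,   m ... 4 2 3 2 4 ... k,

  because the span of these words is stable under right multiplication by letters; their lengths are
  counted by [m] (1 + t^(m-2)). Lower bound: the Fomin--Kirillov algebra carries skew derivations
  d_(ab) with d_t(p q) = p d_t(q) + d_t(p) t(q), where t acts on the indices as a transposition. For
  t = (i, m) they are linear over the subalgebra on the indices below m, and iterated derivations of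
  this kind form a dual system for the words above. Hence the products of these words are linearly
  independent in the Fomin--Kirillov algebra, and both bounds are sharp.
\<close>

subsection \<open>Noncommutative polynomials\<close>

text \<open>The rewriting is therefore done for an abstract predicate on words, in which the claw is
  the only rule that replaces one word by two. In the other half, applying as many derivations as a
  word has letters leaves a scalar and annihilates all shorter words, but not the longer ones. Hence
  longer words are eliminated first, and only words of equal length have to be told apart. For m at
  least 4 this is a small task: only the lengths m - 2 and m - 1 carry two words each. The twist by
  the transposition is what makes derivations in the single index m strong enough. Most letters of a
  word do not contain m, but removing a letter (i, m) interchanges i and m in the letters behind it,
  so that m travels down the tree and, for the long words, back up again; the next derivation is
  chosen to meet it.\<close>

interpretation nc: vector_space "nc_scale :: rat \<Rightarrow> 'a nc \<Rightarrow> 'a nc"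
  by unfold_locales (auto simp: nc_scale_def fun_eq_iff algebra_simps)

lemma ncmul_Nil: "ncmul p q [] = p [] * q []"
  by (simp add: ncmul_def)

text \<open>The cut before the first letter is the separate summand; every other cut leaves the
  first letter in the left factor. This recursion on the argument word replaces sums over cuts in
  later proofs.\<close>

lemma ncmul_Cons: "ncmul p q (y # v) = p [] * q (y # v) + ncmul (\<lambda>w. p (y # w)) q v"
  by (simp add: ncmul_def sum.atMost_Suc_shift del: sum.atMost_Suc)

lemma ncmul_add_left: "ncmul (p + q) r = ncmul p r + ncmul q r"
  by (simp add: ncmul_def fun_eq_iff algebra_simps sum.distrib)

lemma ncmul_add_right: "ncmul r (p + q) = ncmul r p + ncmul r q"
  by (simp add: ncmul_def fun_eq_iff algebra_simps sum.distrib)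

lemma ncmul_scale_left: "ncmul (nc_scale c p) q = nc_scale c (ncmul p q)"
  by (simp add: ncmul_def nc_scale_def fun_eq_iff sum_distrib_left mult.assoc)

lemma ncmul_scale_right: "ncmul p (nc_scale c q) = nc_scale c (ncmul p q)"
  by (simp add: ncmul_def nc_scale_def fun_eq_iff sum_distrib_left mult.left_commute)

lemma ncmul_zero_left [simp]: "ncmul 0 p = 0"
  by (simp add: ncmul_def fun_eq_iff)

lemma ncmul_zero_right [simp]: "ncmul p 0 = 0"
  by (simp add: ncmul_def fun_eq_iff)

lemma ncmul_diff_left: "ncmul (p - q) r = ncmul p r - ncmul q r"
  by (simp add: ncmul_def fun_eq_iff algebra_simps sum_subtractf)

lemma ncmul_diff_right: "ncmul r (p - q) = ncmul r p - ncmul r q"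
  by (simp add: ncmul_def fun_eq_iff algebra_simps sum_subtractf)

lemma ncmul_sum_left: "ncmul (sum f A) q = (\<Sum>i\<in>A. ncmul (f i) q)"
  by (induction A rule: infinite_finite_induct) (simp_all add: ncmul_add_left del: plus_fun_apply zero_fun_apply)

lemma ncmul_one_left [simp]: "ncmul (nc_word []) q = q"
proof
  have z: "(\<lambda>w. nc_word [] (y # w)) = 0" for y :: 'a by (simp add: nc_word_def fun_eq_iff)
  show "ncmul (nc_word []) q v = q v" for v
    by (cases v) (simp_all add: ncmul_Nil ncmul_Cons z, simp_all add: nc_word_def)
qed

lemma ncmul_word_Cons:
  "ncmul (nc_word (x # u)) q (y # v) = (if x = y then ncmul (nc_word u) q v else 0)"
proof -
  have "(\<lambda>w. nc_word (x # u) (y # w)) = (if x = y then nc_word u else 0)"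
    by (auto simp: nc_word_def fun_eq_iff)
  then show ?thesis by (simp add: ncmul_Cons) (simp add: nc_word_def)
qed

lemma ncmul_words: "ncmul (nc_word u) (nc_word v) = nc_word (u @ v)"
proof (induction u)
  case (Cons x u)
  show ?case
  proof
    fix w
    have "nc_word (x # u) [] = 0" by (simp add: nc_word_def)
    then show "ncmul (nc_word (x # u)) (nc_word v) w = nc_word ((x # u) @ v) w"
      by (cases w) (simp_all add: ncmul_word_Cons ncmul_Nil Cons.IH, simp_all add: nc_word_def)
  qed
qed simp

lemma ncmul_one_right [simp]: "ncmul p (nc_word []) = p"
proof
  show "ncmul p (nc_word []) v = p v" for v
    by (induction v arbitrary: p) (simp_all add: ncmul_Nil ncmul_Cons, simp_all add: nc_word_def)
qed

section \<open>Finite support and expansion into words\<close>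

lemma falg_zero [simp]: "0 \<in> falg A"
  by (simp add: falg_def)

lemma falg_add: "p \<in> falg A \<Longrightarrow> q \<in> falg A \<Longrightarrow> p + q \<in> falg A"
proof -
  assume a: "p \<in> falg A" "q \<in> falg A"
  have "{w. (p + q) w \<noteq> 0} \<subseteq> {w. p w \<noteq> 0} \<union> {w. q w \<noteq> 0}" by auto
  then have "finite {w. (p + q) w \<noteq> 0}"
    by (rule finite_subset) (use a in \<open>simp add: falg_def\<close>)
  moreover have "set w \<subseteq> A" if "(p + q) w \<noteq> 0" for w
    using that a by (cases "p w = 0") (auto simp: falg_def)
  ultimately show ?thesis by (simp add: falg_def)
qed

lemma falg_scale: "p \<in> falg A \<Longrightarrow> nc_scale c p \<in> falg A"
proof -
  assume a: "p \<in> falg A"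
  have "{w. nc_scale c p w \<noteq> 0} \<subseteq> {w. p w \<noteq> 0}" by (auto simp: nc_scale_def)
  then have "finite {w. nc_scale c p w \<noteq> 0}"
    by (rule finite_subset) (use a in \<open>simp add: falg_def\<close>)
  then show ?thesis using a by (simp add: falg_def nc_scale_def)
qed

lemma falg_word: "set w \<subseteq> A \<Longrightarrow> nc_word w \<in> falg A"
  by (auto simp: falg_def nc_word_def)

lemma falg_subspace: "nc.subspace (falg A)"
  by (auto simp: nc.subspace_def falg_add falg_scale)

lemma falg_diff: "p \<in> falg A \<Longrightarrow> q \<in> falg A \<Longrightarrow> p - q \<in> falg A"
  by (rule nc.subspace_diff[OF falg_subspace])

lemma falg_mul: "p \<in> falg A \<Longrightarrow> q \<in> falg A \<Longrightarrow> ncmul p q \<in> falg A"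
proof -
  assume a: "p \<in> falg A" "q \<in> falg A"
  have *: "\<exists>u v. w = u @ v \<and> p u \<noteq> 0 \<and> q v \<noteq> 0" if nz: "ncmul p q w \<noteq> 0" for w
  proof -
    obtain i where "p (take i w) * q (drop i w) \<noteq> 0"
      by (rule sum.not_neutral_contains_not_neutral[OF nz[unfolded ncmul_def]])
    then show ?thesis by (intro exI[of _ "take i w"] exI[of _ "drop i w"]) auto
  qed
  have "{w. ncmul p q w \<noteq> 0} \<subseteq> (\<lambda>(u, v). u @ v) ` ({w. p w \<noteq> 0} \<times> {w. q w \<noteq> 0})"
  proof
    fix w assume "w \<in> {w. ncmul p q w \<noteq> 0}"
    then obtain u v where "w = u @ v" "p u \<noteq> 0" "q v \<noteq> 0" using * by blast
    then show "w \<in> (\<lambda>(u, v). u @ v) ` ({w. p w \<noteq> 0} \<times> {w. q w \<noteq> 0})" by force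
  qed
  then have "finite {w. ncmul p q w \<noteq> 0}"
    by (rule finite_subset) (use a in \<open>simp add: falg_def\<close>)
  moreover have "set w \<subseteq> A" if "ncmul p q w \<noteq> 0" for w
  proof -
    obtain u v where "w = u @ v" "p u \<noteq> 0" "q v \<noteq> 0" using *[OF \<open>ncmul p q w \<noteq> 0\<close>] by blast
    then show ?thesis using a by (simp add: falg_def)
  qed
  ultimately show ?thesis by (auto simp: falg_def)
qed

lemma sum_fun_apply: "sum f A x = (\<Sum>i\<in>A. f i x)"
  by (induction A rule: infinite_finite_induct) simp_all

lemma nc_expand: "finite {w. p w \<noteq> 0} \<Longrightarrow> p = (\<Sum>w\<in>{w. p w \<noteq> 0}. nc_scale (p w) (nc_word w))"
  by (rule ext) (simp add: sum_fun_apply nc_scale_def nc_word_def if_distrib cong: if_cong)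

lemma falg_eq_span: "falg A = nc.span {nc_word w | w. set w \<subseteq> A}"
proof
  show "nc.span {nc_word w | w. set w \<subseteq> A} \<subseteq> falg A"
    by (rule nc.span_minimal) (auto simp: falg_word falg_subspace)
  show "falg A \<subseteq> nc.span {nc_word w | w. set w \<subseteq> A}"
  proof
    fix p assume p: "p \<in> falg A"
    have "(\<Sum>w\<in>{w. p w \<noteq> 0}. nc_scale (p w) (nc_word w)) \<in> nc.span {nc_word w | w. set w \<subseteq> A}"
      using p by (intro nc.span_sum nc.span_scale nc.span_base) (auto simp: falg_def)
    then show "p \<in> nc.span {nc_word w | w. set w \<subseteq> A}"
      using nc_expand[of p] p by (simp add: falg_def)
  qed
qed

section \<open>Two-sided ideals\<close>

lemma ideal_gen_subspace: "nc.subspace (ideal_gen A R)"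
proof -
  have "nc_scale c p \<in> ideal_gen A R" if "p \<in> ideal_gen A R" for c p
  proof -
    \<comment> \<open>Scalars enter as multiples of the empty word, since \<open>ideal_gen\<close>
      has no scaling rule of its own.\<close>
    have "ncmul (nc_scale c (nc_word [])) p \<in> ideal_gen A R"
      by (intro ideal_gen.lmul that falg_scale falg_word) simp
    then show ?thesis by (simp add: ncmul_scale_left)
  qed
  then show ?thesis by (auto simp: nc.subspace_def intro: ideal_gen.intros)
qed

lemmas ideal_gen_scale = nc.subspace_scale[OF ideal_gen_subspace]
  and ideal_gen_diff = nc.subspace_diff[OF ideal_gen_subspace]
  and ideal_gen_neg = nc.subspace_neg[OF ideal_gen_subspace]

lemma ideal_gen_context:
  assumes "p \<in> ideal_gen A R" "set u \<subseteq> A" "set v \<subseteq> A"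
  shows "ncmul (nc_word u) (ncmul p (nc_word v)) \<in> ideal_gen A R"
  using assms by (intro ideal_gen.lmul ideal_gen.rmul falg_word)

lemma falg_ncprod: "set ps \<subseteq> falg A \<Longrightarrow> ncprod ps \<in> falg A"
  by (induction ps) (auto simp: ncprod_def falg_word falg_mul)

text \<open>One factor is exchanged at a time: p P - q Q = (p - q) P + q (P - Q).\<close>

lemma ncprod_cong_ideal:
  "list_all2 (\<lambda>p q. p \<in> falg A \<and> q \<in> falg A \<and> p - q \<in> ideal_gen A R) ps qs \<Longrightarrow>
    ncprod ps - ncprod qs \<in> ideal_gen A R"
proof (induction rule: list_all2_induct)
  case Nil
  show ?case by (simp add: ideal_gen.zero del: zero_fun_apply)
next
  case (Cons p ps q qs)
  have "ncprod (p # ps) - ncprod (q # qs) = ncmul (p - q) (ncprod ps) + ncmul q (ncprod ps - ncprod qs)"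
    by (simp add: ncprod_def ncmul_diff_left ncmul_diff_right)
  moreover have "ncprod ps \<in> falg A"
    using Cons.hyps by (intro falg_ncprod) (auto simp: list_all2_conv_all_nth in_set_conv_nth)
  then have "ncmul (p - q) (ncprod ps) + ncmul q (ncprod ps - ncprod qs) \<in> ideal_gen A R"
    using Cons.hyps(1) by (intro ideal_gen.add[OF ideal_gen.rmul ideal_gen.lmul[OF Cons.IH]]) blast+
  ultimately show ?case by (simp only:)
qed

section \<open>Coordinates and complements\<close>

lemma span_image_sum:
  assumes "finite B" "x \<in> nc.span (g ` B)"
  obtains c where "x = (\<Sum>b\<in>B. nc_scale (c b) (g b))"
proof -
  let ?V = "{x. \<exists>c. x = (\<Sum>b\<in>B. nc_scale (c b) (g b))}"
  have "nc.subspace ?V"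
  proof (rule nc.subspaceI)
    show "0 \<in> ?V" by (intro CollectI exI[of _ "\<lambda>_. 0"]) (simp del: zero_fun_apply)
    show "x + y \<in> ?V" if "x \<in> ?V" "y \<in> ?V" for x y
    proof -
      obtain c d where "x = (\<Sum>b\<in>B. nc_scale (c b) (g b))" "y = (\<Sum>b\<in>B. nc_scale (d b) (g b))"
        using \<open>x \<in> ?V\<close> \<open>y \<in> ?V\<close> by blast
      then show ?thesis by (intro CollectI exI[of _ "\<lambda>b. c b + d b"])
          (simp add: nc.scale_left_distrib sum.distrib del: plus_fun_apply)
    qed
    show "nc_scale k x \<in> ?V" if x: "x \<in> ?V" for k x
    proof -
      obtain c where "x = (\<Sum>b\<in>B. nc_scale (c b) (g b))" using x by blast
      then show ?thesis by (intro CollectI exI[of _ "\<lambda>b. k * c b"]) (simp add: nc.scale_sum_right)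
    qed
  qed
  moreover have "g ` B \<subseteq> ?V"
  proof (rule image_subsetI)
    fix b assume "b \<in> B"
    have "(\<Sum>a\<in>B. nc_scale (if a = b then 1 else 0) (g a)) = (\<Sum>a\<in>B. if a = b then g a else 0)"
      by (intro sum.cong) (simp_all del: zero_fun_apply)
    also have "\<dots> = g b" using assms(1) \<open>b \<in> B\<close> by (simp del: zero_fun_apply)
    finally show "g b \<in> ?V" by (intro CollectI exI[of _ "\<lambda>a. if a = b then 1 else 0"]) simp
  qed
  ultimately have "x \<in> ?V" using assms(2) nc.span_minimal by blast
  then show ?thesis using that by blast
qed

text \<open>\<open>W\<close> is the direct sum of \<open>nc.span B\<close> and \<open>U\<close>, so
  a basis of \<open>U\<close> together with \<open>B\<close> is a basis of \<open>W\<close>. The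
  finite generating set \<open>G\<close> makes that basis finite, and additivity makes the
  subtraction of natural numbers exact.\<close>

lemma dim_complement:
  fixes U W B :: "'a nc set"
  assumes "nc.subspace U" "U \<subseteq> W" "W = nc.span G" "finite G" "B \<subseteq> W" "finite B" "nc.independent B"
    "nc.span B \<inter> U \<subseteq> {0}" "\<And>w. w \<in> W \<Longrightarrow> \<exists>x y. w = x + y \<and> x \<in> nc.span B \<and> y \<in> U"
  shows "nc.dim W - nc.dim U = card B"
proof -
  obtain C where C: "C \<subseteq> U" "nc.independent C" "U \<subseteq> nc.span C" "card C = nc.dim U"
    using nc.basis_exists[of U] by metis
  have sC: "nc.span C = U" using C nc.span_minimal[OF _ assms(1)] by blast
  have fC: "finite C"
    using nc.independent_span_bound[OF assms(4) C(2)] C(1) assms(2,3) by blast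
  have disj: "B \<inter> C = {}"
  proof (rule ccontr)
    assume "B \<inter> C \<noteq> {}"
    then obtain v where "v \<in> B" "v \<in> C" by blast
    then have "v = 0" using assms(8) C(1) nc.span_base by blast
    then show False using \<open>v \<in> B\<close> assms(7) nc.dependent_zero by blast
  qed
  have "nc.independent (B \<union> C)"
    unfolding nc.dependent_finite[OF finite_UnI[OF assms(6) fC]]
  proof clarify
    fix u v assume v: "v \<in> B \<union> C" "u v \<noteq> 0" and z: "(\<Sum>v\<in>B \<union> C. nc_scale (u v) v) = 0"
    let ?b = "\<Sum>v\<in>B. nc_scale (u v) v" and ?c = "\<Sum>v\<in>C. nc_scale (u v) v"
    have bc: "?b + ?c = 0" using z by (simp add: sum.union_disjoint[OF assms(6) fC disj] del: plus_fun_apply zero_fun_apply)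
    have b: "?b \<in> nc.span B" by (intro nc.span_sum nc.span_scale nc.span_base)
    have "?c \<in> nc.span C" by (intro nc.span_sum nc.span_scale nc.span_base)
    then have "- ?c \<in> U" using sC nc.subspace_neg[OF assms(1)] by blast
    moreover have "?b = - ?c" using bc by (simp only: eq_neg_iff_add_eq_0)
    ultimately have "?b = 0" using b assms(8) by (metis IntI singletonD subsetD)
    moreover then have "?c = 0" using bc by (simp del: plus_fun_apply zero_fun_apply)
    ultimately show False using v assms(6,7) C(2) fC nc.dependent_finite by blast
  qed
  moreover have "B \<union> C \<subseteq> W" using assms C by blast
  moreover have "W \<subseteq> nc.span (B \<union> C)"
  proof
    fix w assume "w \<in> W"
    then obtain x y where "w = x + y" "x \<in> nc.span B" "y \<in> U" using assms(9) by blast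
    moreover have "nc.span B \<subseteq> nc.span (B \<union> C)" "nc.span C \<subseteq> nc.span (B \<union> C)" by (simp_all add: nc.span_mono)
    ultimately show "w \<in> nc.span (B \<union> C)" using sC nc.span_add by blast
  qed
  ultimately have "card (B \<union> C) = nc.dim W" by (intro nc.basis_card_eq_dim)
  then show ?thesis using C(4) card_Un_disjoint[OF assms(6) fC disj] by simp
qed

subsection \<open>Normal form of words in the edges\<close>

text \<open>The tree is rooted at its branch vertex 1, from which 2, 3 and 4 hang; every later
  vertex hangs from its predecessor.\<close>

definition par :: "nat \<Rightarrow> nat" where
  "par k = (if k \<le> 4 then 1 else k - 1)"

text \<open>Two edges, each named by its child vertex, meet either in the root or at consecutive
  places on the long arm.\<close>

definition adj :: "nat \<Rightarrow> nat \<Rightarrow> bool" where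
  "adj x y \<longleftrightarrow> x \<noteq> y \<and> x \<in> {2..4} \<and> y \<in> {2..4} \<or> 4 \<le> x \<and> y = Suc x \<or> 4 \<le> y \<and> x = Suc y"

definition down :: "nat \<Rightarrow> nat \<Rightarrow> nat list" where
  "down m k = rev [k..<Suc m]"

text \<open>The index \<open>k = Suc m\<close> contributes the empty word. For m at least 4 every
  length from 0 to 2 m - 3 occurs once, except that m - 2 and m - 1 occur twice. The trees on at
  most 3 vertices are paths, and their words are the usual coset representatives of a nil-Coxeter
  algebra up to sign.\<close>

definition reps :: "nat \<Rightarrow> nat list set" where
  "reps m = (if m \<le> 1 then {[]} else if m = 2 then {[], [2]} else if m = 3 then {[], [3], [3, 2]}
    else (\<lambda>k. down m k) ` {4..Suc m}
      \<union> (\<lambda>s. down m 4 @ s) ` {[2], [3], [2, 3], [3, 2], [2, 3, 2]}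
      \<union> (\<lambda>k. down m 4 @ [2, 3, 2] @ [4..<Suc k]) ` {4..m})"

lemma reps_cases [consumes 2, case_names down middle return]:
  assumes "r \<in> reps m" "4 \<le> m"
  obtains (down) k where "k \<in> {4..Suc m}" "r = down m k"
    | (middle) s where "s \<in> {[2], [3], [2, 3], [3, 2], [2, 3, 2]}" "r = down m 4 @ s"
    | (return) k where "k \<in> {4..m}" "r = down m 4 @ [2, 3, 2] @ [4..<Suc k]"
  using assms by (auto simp: reps_def split: if_splits)

fun basis_words :: "nat \<Rightarrow> nat list set" where
  "basis_words 0 = {[]}"
| "basis_words (Suc m) = {u @ r | u r. u \<in> basis_words m \<and> r \<in> reps (Suc m)}"

text \<open>\<open>P\<close> stands for membership of a word in a subspace that contains the
  relations: every axiom derives \<open>P\<close> of one word of a relation from \<open>P\<close> of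
  its remaining words. Coefficients disappear, while lengths are preserved.\<close>

locale reduction =
  fixes P :: "nat list \<Rightarrow> bool"
  assumes sq: "P (u @ x # x # v)"
    and comm: "x \<noteq> y \<Longrightarrow> \<not> adj x y \<Longrightarrow> P (u @ y # x # v) \<Longrightarrow> P (u @ x # y # v)"
    and braid: "adj x y \<Longrightarrow> P (u @ y # x # y # v) \<Longrightarrow> P (u @ x # y # x # v)"
    and claw: "{x, y} = {2, 3} \<Longrightarrow> P (u @ x # y # 4 # x # v) \<Longrightarrow> P (u @ y # 4 # x # y # v)
      \<Longrightarrow> P (u @ 4 # x # y # 4 # v)"
begin

text \<open>Allows an induction to rewrite a prefix while a fixed suffix is carried along inside the
  predicate.\<close>

lemma append_right: "reduction (\<lambda>w. P (w @ s))"
  by unfold_locales (auto intro: sq comm braid claw)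

lemma move_left: "\<forall>y\<in>set s. x \<noteq> y \<and> \<not> adj x y \<Longrightarrow> P (u @ x # s @ v) \<Longrightarrow> P (u @ s @ x # v)"
proof (induction s arbitrary: u)
  case (Cons y s)
  have "P ((u @ [y]) @ x # s @ v)"
    using comm[of y x u "s @ v"] Cons.prems by (auto simp: adj_def)
  from Cons.IH[OF _ this] Cons.prems(1) show ?case by simp
qed simp

end

lemma set_down [simp]: "set (down m k) = {k..m}"
  by (auto simp: down_def)

lemma down_empty: "m < k \<Longrightarrow> down m k = []"
  by (simp add: down_def)

lemma down_split: "0 < x \<Longrightarrow> k \<le> x \<Longrightarrow> x \<le> m \<Longrightarrow> down m k = down m (Suc x) @ x # down (x - 1) k"
proof -
  assume a: "0 < x" "k \<le> x" "x \<le> m"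
  then have "[k..<Suc m] = [k..<x] @ x # [Suc x..<Suc m]"
    using upt_add_eq_append[of k x "Suc m - x"] upt_conv_Cons[of x "Suc m"] by simp
  then show ?thesis using a by (cases x) (auto simp: down_def)
qed

context reduction
begin

text \<open>The letter x moves left past the letters below x - 1, then x (x-1) x is exchanged for
  (x-1) x (x-1), and the first x - 1 commutes with all letters above x. A letter crossing a descent
  thus drops by one.\<close>

lemma down_inner:
  assumes "4 \<le> k" "k < x" "x \<le> m" "P (u @ (x - 1) # down m k @ v)"
  shows "P (u @ down m k @ x # v)"
proof -
  have e: "down m k = down m (Suc x) @ x # (x - 1) # down (x - 2) k"
    using down_split[of x k m] down_split[of "x - 1" k "x - 1"] assms
    by (simp add: down_empty numeral_2_eq_2)
  have "P ((u @ down m (Suc x)) @ (x - 1) # x # (x - 1) # down (x - 2) k @ v)"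
    using move_left[of "down m (Suc x)" "x - 1" u "x # (x - 1) # down (x - 2) k @ v"] assms
    by (simp add: e) (force simp: adj_def)
  then have "P ((u @ down m (Suc x)) @ x # (x - 1) # x # down (x - 2) k @ v)"
    by (rule braid[rotated]) (use assms in \<open>auto simp: adj_def\<close>)
  then have "P ((u @ down m (Suc x) @ [x, x - 1]) @ down (x - 2) k @ x # v)"
    using move_left[of "down (x - 2) k" x "u @ down m (Suc x) @ [x, x - 1]" v] assms
    by (simp) (force simp: adj_def)
  then show ?thesis by (simp add: e)
qed

text \<open>A letter multiplied from the right either lengthens the representative, or produces a
  square, or is converted into letters below m that join the left factor. \<open>L\<close> is fixed
  because \<open>H\<close> is only available for normal words of the length in question.\<close>

lemma reps_step:
  assumes m: "4 \<le> m"
    and H: "\<And>u r. set u \<subseteq> {2..<m} \<Longrightarrow> r \<in> reps m \<Longrightarrow> length u + length r = L \<Longrightarrow> P (u @ r)"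
    and u: "set u \<subseteq> {2..<m}" and r: "r \<in> reps m" and x: "x \<in> {2..m}"
    and L: "Suc (length u + length r) = L"
  shows "P (u @ r @ [x])"
proof -
  let ?D = "down m 4" and ?E = "down m 5"
  have len: "length (down m k) = Suc m - k" for k by (auto simp: down_def)
  have D: "?D = ?E @ [4]" using down_split[of 4 4 m] m by (simp add: down_def)
  have HA: "P (v @ down m k)" if "set v \<subseteq> {2..<m}" "k \<in> {4..Suc m}" "length v + (Suc m - k) = L" for v k
    using H[of v "down m k"] that m by (auto simp: reps_def len)
  have HB: "P (v @ ?D @ s)" if "set v \<subseteq> {2..<m}" "s \<in> {[2], [3], [2, 3], [3, 2], [2, 3, 2]}"
      "length v + (m - 3) + length s = L" for v s
    using H[of v "?D @ s"] that m by (auto simp: reps_def len)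
  have HC: "P (v @ ?D @ [2, 3, 2] @ [4..<Suc k])"
    if "set v \<subseteq> {2..<m}" "k \<in> {4..m}" "length v + m + (k - 3) = L" for v k
    using H[of v "?D @ [2, 3, 2] @ [4..<Suc k]"] that m by (auto simp: reps_def len)
  have past: "P (u @ ?E @ a # v)" if "a \<in> {2, 3}" "P (u @ a # ?E @ v)" for u a v
    by (rule move_left) (use that in \<open>auto simp: adj_def\<close>)
  have inner: "P (u @ ?D @ y # v)" if "y \<in> {5..m}" "P (u @ (y - 1) # ?D @ v)" for u y v
    by (rule down_inner) (use that in auto)
  have sq': "P (u @ v @ [a, a])" "P (u @ v @ a # a # w)" for u v w a
    using sq[of "u @ v" a] by auto
  from r m show ?thesis
  proof (cases rule: reps_cases)
    case (down k)
    note A = this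
    consider "5 \<le> k" "Suc x < k" | "5 \<le> k" "Suc x = k" | "x = k" | "k < x" | "k = 4" "x \<in> {2, 3}"
      using A x by force
    then show ?thesis
    proof cases
      case 1
      \<comment> \<open>No letter of the descent is adjacent to x, which therefore joins the left
        factor.\<close>
      have "P ((u @ [x]) @ down m k)" using HA[of "u @ [x]" k] u x L 1 A by (auto simp: len)
      then show ?thesis using move_left[of "down m k" x u "[]"] 1 A by (auto simp: adj_def)
    next
      case 2
      have "down m k @ [x] = down m x" using down_split[of x x m] 2 A x by (auto simp: down_def)
      then show ?thesis using HA[of u x] u L 2 A by (auto simp: len)
    next
      case 3
      then have "down m k = down m (Suc k) @ [k]" using down_split[of k k m] A x by (auto simp: down_def)
      then show ?thesis using 3 A sq' by simp
    next
      case 4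
      have "P ((u @ [x - 1]) @ down m k)"
        by (rule HA) (use u x L 4 A in \<open>auto simp: len\<close>)
      then show ?thesis using down_inner[of k x m u "[]"] 4 A x by auto
    next
      case 5
      then show ?thesis using HB[of u "[x]"] A u L by (auto simp: len)
    qed
  next
    case (middle s)
    note B = this
    show ?thesis
    proof (cases "5 \<le> x")
      case True
      have "P ((u @ [x - 1]) @ ?D @ s)"
        using HB[of "u @ [x - 1]" s] B u x L True m by (fastforce simp: len)
      then have "P (u @ ?D @ x # s)" using inner[of x u s] x True by simp
      then have "P ((u @ ?D) @ s @ x # [])"
        using move_left[of s x "u @ ?D" "[]"] B True by (auto simp: adj_def)
      then show ?thesis using B by simp
    next
      case False
      then consider "x = 2" | "x = 3" | "x = 4" using x by force
      then show ?thesis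
      proof cases
        case 1
        have "P (u @ ?D @ [2, 3, 2])" if "s = [2, 3]" using HB[of u "[2, 3, 2]"] B u L that m by (auto simp: len)
        moreover have "P (u @ ?D @ [3, 2])" if "s = [3]" using HB[of u "[3, 2]"] B u L that m by (auto simp: len)
        ultimately show ?thesis using B 1 sq'[of u ?D 2] sq'[of u "?D @ [3]" 2] sq'[of u "?D @ [2, 3]" 2] by auto
      next
        case 2
        have "P (u @ ?D @ [2, 3])" if "s = [2]" using HB[of u "[2, 3]"] B u L that m by (auto simp: len)
        moreover have "P (u @ ?D @ [3, 2, 3])" if "s = [3, 2]"
          using HB[of u "[2, 3, 2]"] braid[of 3 2 "u @ ?D" "[]"] B u L that m by (auto simp: len adj_def)
        moreover have "P (u @ ?D @ [2, 3, 2, 3])"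
          using braid[of 2 3 "u @ ?D" "[3]"] sq'[of u "?D @ [3, 2]" 3] by (auto simp: adj_def)
        ultimately show ?thesis using B 2 sq'[of u ?D 3] sq'[of u "?D @ [2]" 3] by auto
      next
        case 3
        \<comment> \<open>4 a 4 is exchanged for a 4 a, and a commutes with 5, ..., m.\<close>
        have one: "P (u @ ?D @ [a, 4])" if "s = [a]" "a \<in> {2, 3}" for a
        proof -
          have "P ((u @ [a]) @ ?D @ [a])" using HB[of "u @ [a]" "[a]"] B u L that m by (auto simp: len)
          then have "P ((u @ ?E) @ a # 4 # [a])" using past[of a u "[4, a]"] that by (simp add: D)
          then show ?thesis using braid[of 4 a "u @ ?E" "[]"] that by (auto simp: D adj_def)
        qed
        \<comment> \<open>The claw replaces 4 a b 4 by a b 4 a and b 4 a b. The letters in front of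
          4 pass over \<open>?E\<close> into the left factor, leaving \<open>?D\<close> followed by
          a and by a b.\<close>
        have two: "P (u @ ?D @ [a, b, 4])" if "s = [a, b]" "{a, b} = {2, 3}" for a b
        proof -
          have ab: "a \<in> {2, 3}" "b \<in> {2, 3}" "2 \<le> a" "2 \<le> b" "a < m" "b < m" "[a, b] = [2, 3] \<or> [a, b] = [3, 2]"
            using that m by (auto simp: doubleton_eq_iff)
          have "P ((u @ [a, b]) @ ?D @ [a])"
            by (rule HB) (use B u L that m ab in \<open>simp_all add: len\<close>)
          then have "P ((u @ ?E) @ a # b # 4 # [a])"
            using past[of a u "[b, 4, a]"] past[of b "u @ [a]" "[4, a]"] ab by (simp add: D)
          moreover have "P ((u @ [b]) @ ?D @ [a, b])"
            by (rule HB) (use B u L that m ab in \<open>simp_all add: len\<close>)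
          then have "P ((u @ ?E) @ b # 4 # [a, b])" using past[of b u "[4, a, b]"] ab by (simp add: D)
          ultimately show ?thesis using claw[of a b "u @ ?E" "[]"] that by (auto simp: D)
        qed
        have "P (u @ ?D @ [2, 3, 2, 4])" if "s = [2, 3, 2]" using HC[of u 4] B u L that m by (auto simp: len)
        then show ?thesis using B 3 one two by (auto simp: insert_commute)
      qed
    qed
  next
    case (return k)
    note C = this
    let ?W = "[2, 3, 2] @ [4..<Suc k]"
    have pre: "P (u @ y # ?D @ ?W)" if "y \<in> {2..<m}" for y
      using HC[of "u @ [y]" k] C u L that by (auto simp: len)
    consider "x = k" | "x = Suc k" | "Suc k < x" | "4 \<le> x" "x < k" | "x \<in> {2, 3}" using x C by force
    then show ?thesis
    proof cases
      case 1
      then show ?thesis using C sq'[of u "?D @ [2, 3, 2] @ [4..<k]" k] by simp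
    next
      case 2
      then show ?thesis using HC[of u "Suc k"] C u L x by (auto simp: len)
    next
      case 3
      have "P (u @ ?D @ x # ?W)" by (intro inner pre) (use x 3 C in auto)
      then have "P ((u @ ?D) @ ?W @ x # [])"
        using move_left[of ?W x "u @ ?D" "[]"] C 3 by (auto simp: adj_def)
      then show ?thesis using C by simp
    next
      case 4
      \<comment> \<open>The letter x commutes with \<open>Y\<close>, and x (x+1) x is exchanged for
        (x+1) x (x+1). The first x + 1 then travels left to \<open>?D\<close> and crosses it,
        arriving in front as x.\<close>
      define Y where "Y = [Suc (Suc x)..<Suc k]"
      have e: "[4..<Suc k] = [4..<x] @ x # Suc x # Y"
        using upt_add_eq_append[of 4 x "Suc k - x"] upt_conv_Cons[of x "Suc k"]
          upt_conv_Cons[of "Suc x" "Suc k"] 4 by (simp add: Y_def)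
      have "P (u @ ?D @ Suc x # ?W)" by (intro inner pre) (use 4 C in auto)
      then have "P ((u @ ?D) @ Suc x # ([2, 3, 2] @ [4..<x]) @ x # Suc x # Y)" unfolding e by simp
      then have "P ((u @ ?D) @ ([2, 3, 2] @ [4..<x]) @ Suc x # x # Suc x # Y)"
        by (rule move_left[of "[2, 3, 2] @ [4..<x]" "Suc x" "u @ ?D", rotated])
          (use 4 in \<open>auto simp: adj_def\<close>)
      then have "P ((u @ ?D @ [2, 3, 2] @ [4..<x]) @ x # Suc x # x # Y)"
        using braid[of x "Suc x" "u @ ?D @ [2, 3, 2] @ [4..<x]" Y] 4 by (auto simp: adj_def)
      then have "P ((u @ ?D @ [2, 3, 2] @ [4..<x] @ [x, Suc x]) @ x # Y @ [])" by simp
      moreover have nb: "\<forall>y\<in>set Y. x \<noteq> y \<and> \<not> adj x y"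
      proof
        fix y assume "y \<in> set Y"
        then have "Suc (Suc x) \<le> y" by (simp add: Y_def del: upt_Suc)
        then show "x \<noteq> y \<and> \<not> adj x y" using 4 by (simp add: adj_def)
      qed
      ultimately have "P ((u @ ?D @ [2, 3, 2] @ [4..<x] @ [x, Suc x]) @ Y @ x # [])"
        using move_left by blast
      then show ?thesis using C unfolding e by simp
    next
      case 5
      \<comment> \<open>Here y is the other one of 2 and 3. After x has passed \<open>V\<close>, the
        ending x 4 x becomes 4 x 4, which creates 4 x y 4. Of the two words given by its claw one
        contains the square x x; in the other y leaves over \<open>?E\<close>, and a representative
        of the same shape remains.\<close>
      define y :: nat where "y = 5 - x"
      have xy: "(x = 2 \<and> y = 3) \<or> (x = 3 \<and> y = 2)" using 5 by (auto simp: y_def)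
      define V where "V = [5..<Suc k]"
      have e: "[4..<Suc k] = 4 # V" using upt_conv_Cons[of 4 "Suc k"] C by (simp add: V_def)
      have "P (u @ y # ?D @ [2, 3, 2, 4] @ V)" using pre[of y] xy m unfolding e by auto
      then have "P (u @ y # ?D @ [x, y, x, 4] @ V)"
        using xy braid[of 3 2 "u @ y # ?D" "4 # V"] by (auto simp: adj_def)
      then have a: "P ((u @ ?E) @ y # 4 # x # y # [x, 4] @ V)" using past[of y u] xy by (auto simp: D)
      have "P (u @ (?E @ [x, y, 4]) @ x # x # 4 # V)" by (rule sq'(2)[unfolded append_assoc])
      then have "P ((u @ ?E) @ 4 # x # y # 4 # [x, 4] @ V)"
        using claw[of x y "u @ ?E"] a xy by auto
      then have "P ((u @ ?D @ [x, y]) @ x # 4 # x # V)"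
        using braid[of x 4 "u @ ?D @ [x, y]" V] xy by (auto simp: adj_def D)
      then have "P (u @ ?D @ [2, 3, 2, 4, x] @ V)"
        using xy braid[of 2 3 "u @ ?D" "4 # 3 # V"] by (auto simp: adj_def)
      then have "P ((u @ ?D @ [2, 3, 2, 4]) @ x # V @ [])" by simp
      then have "P ((u @ ?D @ [2, 3, 2, 4]) @ V @ x # [])"
        by (rule move_left[of V x "u @ ?D @ [2, 3, 2, 4]" "[]", rotated]) (use xy in \<open>auto simp: adj_def V_def\<close>)
      then show ?thesis using C unfolding e by simp
    qed
  qed
qed

end

lemma reps_step_small:
  assumes "reduction P" "m \<in> {2, 3}"
    and H: "\<And>u r. set u \<subseteq> {2..<m} \<Longrightarrow> r \<in> reps m \<Longrightarrow> length u + length r = L \<Longrightarrow> P (u @ r)"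
    and u: "set u \<subseteq> {2..<m}" and r: "r \<in> reps m" and x: "x \<in> {2..m}"
    and L: "Suc (length u + length r) = L"
  shows "P (u @ r @ [x])"
proof -
  interpret reduction P by fact
  from assms(2) consider "m = 2" | "m = 3" by blast
  then show ?thesis
  proof cases
    case 1
    then show ?thesis using r x L sq[of u 2 "[]"] H[OF u, of "[2]"] by (auto simp: reps_def)
  next
    case 2
    have "P (u @ [3, 2, 3])" if "r = [3, 2]"
      using H[of "u @ [2]" "[3, 2]"] braid[of 3 2 u "[]"] u L 2 that by (auto simp: reps_def adj_def)
    moreover have "P (u @ [2])" if "r = []" using H[of "u @ [2]" "[]"] u L 2 that by (auto simp: reps_def)
    moreover have "P (u @ [3])" if "r = []" using H[of u "[3]"] u L 2 that by (auto simp: reps_def)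
    moreover have "P (u @ [3, 2])" if "r = [3]" using H[of u "[3, 2]"] u L 2 that by (auto simp: reps_def)
    moreover have "x = 2 \<or> x = 3" using x 2 by auto
    ultimately show ?thesis using r 2 sq[of u 3 "[]"] sq[of "u @ [3]" 2 "[]"] by (auto simp: reps_def)
  qed
qed

text \<open>Induction from the right end, with the predicate varying: for
  \<open>\<lambda>w. P (w @ [x])\<close> the prefix is brought to the form \<open>u @ r\<close>,
  after which \<open>r\<close> absorbs x.\<close>

lemma reps_reduce:
  assumes "reduction P" "2 \<le> m"
    and H: "\<And>u r. set u \<subseteq> {2..<m} \<Longrightarrow> r \<in> reps m \<Longrightarrow> length u + length r = length w \<Longrightarrow> P (u @ r)"
    and "set w \<subseteq> {2..m}"
  shows "P w"
  using assms
proof (induction w arbitrary: P rule: rev_induct)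
  case Nil
  have "[] \<in> reps m" by (auto simp: reps_def down_def intro!: image_eqI[of _ _ "Suc m"])
  then show ?case using Nil.prems(3)[of "[]" "[]"] by simp
next
  case (snoc x w)
  interpret reduction P by fact
  have "P (w @ [x])"
  proof (rule snoc.IH[of "\<lambda>w. P (w @ [x])"])
    fix u r assume "set u \<subseteq> {2..<m}" "r \<in> reps m" "length u + length r = length w"
    then show "P ((u @ r) @ [x])"
      using reps_step[of m "length (w @ [x])" u r x] reps_step_small[OF snoc.prems(1), of m "length (w @ [x])" u r x]
        snoc.prems by (cases "4 \<le> m"; cases "m = 2"; cases "m = 3") auto
  qed (use append_right snoc.prems in auto)
  then show ?case .
qed

text \<open>The left factor produced by \<open>reps_reduce\<close> is a word of the next smaller
  tree and is reduced in turn, with \<open>r\<close> kept as a suffix.\<close>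

lemma basis_words_reduce:
  assumes "reduction P" "\<And>b. b \<in> basis_words m \<Longrightarrow> length b = length w \<Longrightarrow> P b" "set w \<subseteq> {2..m}"
  shows "P w"
  using assms
proof (induction m arbitrary: P w)
  case (Suc m)
  interpret reduction P by fact
  show ?case
  proof (cases "2 \<le> Suc m")
    case True
    show ?thesis
    proof (rule reps_reduce[OF Suc.prems(1) True _ Suc.prems(3)])
      fix u r assume a: "set u \<subseteq> {2..<Suc m}" "r \<in> reps (Suc m)" "length u + length r = length w"
      show "P (u @ r)"
      proof (rule Suc.IH[of "\<lambda>w. P (w @ r)"])
        show "P (b @ r)" if "b \<in> basis_words m" "length b = length u" for b
          using Suc.prems(2)[of "b @ r"] that a by auto
      qed (use a append_right in auto)
    qed
  next
    case False
    then have "m = 0" by simp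
    then show ?thesis using Suc.prems(2)[of "[]"] Suc.prems(3) by (auto simp: reps_def)
  qed
qed simp

subsection \<open>Skew derivations\<close>

text \<open>The two-sided ideal of the Fomin--Kirillov relations with arbitrary, not necessarily finitely
  supported, multipliers: the skew derivations act on all functions on words, so no support
  conditions have to be tracked.\<close>

inductive_set FK_ideal :: "(nat \<times> nat) nc set" where
  zero: "0 \<in> FK_ideal"
| base: "r \<in> fk_rels n \<Longrightarrow> r \<in> FK_ideal"
| add: "p \<in> FK_ideal \<Longrightarrow> q \<in> FK_ideal \<Longrightarrow> p + q \<in> FK_ideal"
| lmul: "p \<in> FK_ideal \<Longrightarrow> ncmul q p \<in> FK_ideal"
| rmul: "p \<in> FK_ideal \<Longrightarrow> ncmul p q \<in> FK_ideal"

lemma fk_ideal_subset: "fk_ideal n \<subseteq> FK_ideal"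
proof
  show "p \<in> FK_ideal" if "p \<in> fk_ideal n" for p
    using that unfolding fk_ideal_def by induction (blast intro: FK_ideal.intros)+
qed

lemma FK_ideal_scale: "p \<in> FK_ideal \<Longrightarrow> nc_scale c p \<in> FK_ideal"
  using FK_ideal.lmul[of p "nc_scale c (nc_word [])"] by (simp add: ncmul_scale_left)

lemma FK_ideal_neg: "p \<in> FK_ideal \<Longrightarrow> - p \<in> FK_ideal"
  using FK_ideal_scale[of p "-1"] by (simp add: nc_scale_def fun_Compl_def)

lemma FK_ideal_diff: "p \<in> FK_ideal \<Longrightarrow> q \<in> FK_ideal \<Longrightarrow> p - q \<in> FK_ideal"
  using FK_ideal.add[OF _ FK_ideal_neg, of p q] by simp

lemma FK_ideal_subspace: "nc.subspace FK_ideal"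
  by (simp add: nc.subspace_def FK_ideal.zero FK_ideal.add FK_ideal_scale)

lemma nc_gens_mul: "ncmul (nc_gen x) (nc_gen y) = nc_word [x, y]"
  by (simp add: nc_gen_def ncmul_words)

lemma fk_rels_intros:
  assumes "i \<in> {1..n}" "j \<in> {1..n}" "i \<noteq> j"
  shows fk_rels_anti: "nc_gen (i, j) + nc_gen (j, i) \<in> fk_rels n"
    and fk_rels_sq: "nc_word [(i, j), (i, j)] \<in> fk_rels n"
    and fk_rels_comm: "k \<in> {1..n} \<Longrightarrow> l \<in> {1..n} \<Longrightarrow> distinct [i, j, k, l] \<Longrightarrow>
      nc_word [(i, j), (k, l)] - nc_word [(k, l), (i, j)] \<in> fk_rels n"
    and fk_rels_triple: "k \<in> {1..n} \<Longrightarrow> distinct [i, j, k] \<Longrightarrow>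
      nc_word [(i, j), (j, k)] + nc_word [(j, k), (k, i)] + nc_word [(k, i), (i, j)] \<in> fk_rels n"
  unfolding fk_rels_def nc_gens_mul using assms by blast+

lemma fk_rels_cases:
  assumes "r \<in> fk_rels n"
  obtains (anti) i j where "r = nc_gen (i, j) + nc_gen (j, i)" "i \<in> {1..n}" "j \<in> {1..n}" "i \<noteq> j"
    | (sq) i j where "r = nc_word [(i, j), (i, j)]" "i \<in> {1..n}" "j \<in> {1..n}" "i \<noteq> j"
    | (comm) i j k l where "r = nc_word [(i, j), (k, l)] - nc_word [(k, l), (i, j)]"
        "i \<in> {1..n}" "j \<in> {1..n}" "k \<in> {1..n}" "l \<in> {1..n}" "distinct [i, j, k, l]"
    | (triple) i j k where
        "r = nc_word [(i, j), (j, k)] + nc_word [(j, k), (k, i)] + nc_word [(k, i), (i, j)]"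
        "i \<in> {1..n}" "j \<in> {1..n}" "k \<in> {1..n}" "distinct [i, j, k]"
  using assms unfolding fk_rels_def nc_gens_mul by blast

lemma FK_ideal_Nil: "p \<in> FK_ideal \<Longrightarrow> p [] = 0"
proof (induction rule: FK_ideal.induct)
  case (base r n)
  then show ?case by (auto simp: fk_rels_def nc_gens_mul) (auto simp: nc_gen_def nc_word_def)
qed (simp_all add: ncmul_Nil)

definition tri :: "nat \<times> nat \<Rightarrow> nat \<Rightarrow> nat" where
  "tri t i = (if i = fst t then snd t else if i = snd t then fst t else i)"

definition tr :: "nat \<times> nat \<Rightarrow> nat \<times> nat \<Rightarrow> nat \<times> nat" where
  "tr t = map_prod (tri t) (tri t)"

lemma tr_tr [simp]: "tr t (tr t x) = x" "tr t \<circ> tr t = id"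
  by (cases x; simp add: tr_def tri_def) (auto simp: tr_def tri_def fun_eq_iff)

text \<open>This is a pullback of functions, but \<open>tr t\<close> is an involution, so on words
  it is also the letterwise action.\<close>

definition act :: "nat \<times> nat \<Rightarrow> (nat \<times> nat) nc \<Rightarrow> (nat \<times> nat) nc" where
  "act t p = (\<lambda>w. p (map (tr t) w))"

text \<open>On words, sder t (x w) = <t, x> t(w) + x sder t w, where t acts as a transposition on the
  indices and <t, x> is 1, -1 or 0; the definition below is the transpose of this rule.\<close>

primrec sder :: "nat \<times> nat \<Rightarrow> (nat \<times> nat) nc \<Rightarrow> (nat \<times> nat) nc" where
  "sder t p [] = p [t] - p [prod.swap t]"
| "sder t p (y # v) = p (t # map (tr t) (y # v)) - p (prod.swap t # map (tr t) (y # v))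
    + sder t (\<lambda>w. p (y # w)) v"

lemma sder_add: "sder t (p + q) = sder t p + sder t q"
proof
  show "sder t (p + q) v = (sder t p + sder t q) v" for v
  proof (induction v arbitrary: p q)
    case (Cons y v)
    have "(\<lambda>w. (p + q) (y # w)) = (\<lambda>w. p (y # w)) + (\<lambda>w. q (y # w))" by (simp add: fun_eq_iff)
    with Cons show ?case by (simp del: plus_fun_apply) simp
  qed simp
qed

lemma sder_scale: "sder t (nc_scale c p) = nc_scale c (sder t p)"
proof
  show "sder t (nc_scale c p) v = nc_scale c (sder t p) v" for v
  proof (induction v arbitrary: p)
    case (Cons y v)
    have "(\<lambda>w. nc_scale c p (y # w)) = nc_scale c (\<lambda>w. p (y # w))" by (simp add: nc_scale_def)
    with Cons show ?case by simp (simp add: nc_scale_def algebra_simps)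
  qed (simp add: nc_scale_def algebra_simps)
qed

lemma sder_zero: "sder t 0 = 0"
  using sder_scale[of t 0 0] by (simp add: nc_scale_def zero_fun_def)

lemma sder_neg: "sder t (- p) = - sder t p"
  using sder_add[of t p "- p"] by (simp add: sder_zero eq_neg_iff_add_eq_0 add.commute)

lemma sder_diff: "sder t (p - q) = sder t p - sder t q"
  using sder_add[of t p "- q"] by (simp add: sder_neg)

lemma act_ncmul: "act t (ncmul p q) = ncmul (act t p) (act t q)"
  by (simp add: act_def ncmul_def fun_eq_iff take_map drop_map)

text \<open>The twisted Leibniz rule. \<open>p\<close> is generalised in the induction because the
  recursion strips its first letter.\<close>

lemma sder_ncmul: "sder t (ncmul p q) = ncmul p (sder t q) + ncmul (sder t p) (act t q)"
proof
  show "sder t (ncmul p q) v = (ncmul p (sder t q) + ncmul (sder t p) (act t q)) v" for v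
  proof (induction v arbitrary: p)
    case Nil
    show ?case by (simp add: ncmul_Nil ncmul_Cons act_def algebra_simps)
  next
    case (Cons y v)
    \<comment> \<open>\<open>a\<close> and \<open>b\<close> collect the words of \<open>p\<close>
      beginning with t and with its reversal: that letter is removed and t acts on the rest. On
      nonempty words \<open>sder t p\<close> is their difference plus the recursive term.\<close>
    define a where "a = act t (\<lambda>w. p (t # w))"
    define b where "b = act t (\<lambda>w. p (prod.swap t # w))"
    let ?py = "\<lambda>w. p (y # w)"
    have act2: "ncmul r q (map (tr t) (y # v)) = ncmul (act t r) (act t q) (y # v)" for r
      using fun_cong[OF act_ncmul[of t r q], of "y # v"] unfolding act_def[of t "ncmul r q"] .
    have e1: "(\<lambda>w. ncmul p q (y # w)) = nc_scale (p []) (\<lambda>w. q (y # w)) + ncmul ?py q"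
      by (simp add: fun_eq_iff ncmul_Cons nc_scale_def)
    have e2: "(\<lambda>w. sder t p (y # w)) = (\<lambda>w. a (y # w)) - (\<lambda>w. b (y # w)) + sder t ?py"
      by (simp add: fun_eq_iff a_def b_def act_def)
    have "sder t (ncmul p q) (y # v) =
        p [] * q (t # map (tr t) (y # v)) + ncmul a (act t q) (y # v)
        - (p [] * q (prod.swap t # map (tr t) (y # v)) + ncmul b (act t q) (y # v))
        + (p [] * sder t (\<lambda>w. q (y # w)) v
        + (ncmul ?py (sder t q) v + ncmul (sder t ?py) (act t q) v))"
      unfolding sder.simps ncmul_Cons[of p q t] ncmul_Cons[of p q "prod.swap t"] act2 e1 sder_add
        sder_scale plus_fun_apply Cons.IH a_def b_def
      by (simp add: nc_scale_def)
    also have "ncmul a (act t q) (y # v) = a [] * act t q (y # v) + ncmul (\<lambda>w. a (y # w)) (act t q) v"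
      by (rule ncmul_Cons)
    also have "ncmul b (act t q) (y # v) = b [] * act t q (y # v) + ncmul (\<lambda>w. b (y # w)) (act t q) v"
      by (rule ncmul_Cons)
    finally have L: "sder t (ncmul p q) (y # v) = p [] * sder t q (y # v) + ncmul ?py (sder t q) v
        + (a [] - b []) * act t q (y # v)
        + (ncmul (\<lambda>w. a (y # w)) (act t q) v - ncmul (\<lambda>w. b (y # w)) (act t q) v
           + ncmul (sder t ?py) (act t q) v)"
      by (simp add: algebra_simps)
    have "ncmul (sder t p) (act t q) (y # v) = sder t p [] * act t q (y # v)
        + ncmul (\<lambda>w. sder t p (y # w)) (act t q) v"
      by (rule ncmul_Cons)
    also have "\<dots> = (a [] - b []) * act t q (y # v)
        + (ncmul (\<lambda>w. a (y # w)) (act t q) v - ncmul (\<lambda>w. b (y # w)) (act t q) v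
           + ncmul (sder t ?py) (act t q) v)"
      unfolding e2 ncmul_add_left ncmul_diff_left by (simp add: a_def b_def act_def)
    finally show ?case unfolding L by (simp add: ncmul_Cons[of p "sder t q"])
  qed
qed

lemma sder_vanish:
  assumes "\<And>w. p w \<noteq> 0 \<Longrightarrow> t \<notin> set w \<and> prod.swap t \<notin> set w"
  shows "sder t p = 0"
proof
  show "sder t p v = 0 v" for v
    using assms
  proof (induction v arbitrary: p)
    case (Cons y v)
    have "sder t (\<lambda>w. p (y # w)) v = 0 v"
      by (rule Cons.IH) (use Cons.prems in force)
    moreover have "p (t # w) = 0" "p (prod.swap t # w) = 0" for w using Cons.prems by force+
    ultimately show ?case by simp
  next
    case Nil
    have "p [t] = 0" "p [prod.swap t] = 0" using Nil.prems by force+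
    then show ?case by simp
  qed
qed

definition pair :: "nat \<times> nat \<Rightarrow> nat \<times> nat \<Rightarrow> rat" where
  "pair t x = (if x = t then 1 else 0) - (if x = prod.swap t then 1 else 0)"

lemma pair_swap: "pair t (prod.swap x) = - pair t x"
proof -
  have "prod.swap x = t \<longleftrightarrow> x = prod.swap t" "prod.swap x = prod.swap t \<longleftrightarrow> x = t"
    by (auto simp: prod_eq_iff)
  then show ?thesis by (simp add: pair_def)
qed

lemma sder_word_Nil: "sder t (nc_word []) = 0"
  by (rule sder_vanish) (simp add: nc_word_def split: if_splits)

lemma act_word: "act t (nc_word w) = nc_word (map (tr t) w)"
proof -
  have "map (tr t) v = w \<longleftrightarrow> v = map (tr t) w" for v by auto
  then show ?thesis by (simp add: act_def nc_word_def)
qed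

lemma sder_gen: "sder t (nc_gen x) = nc_scale (pair t x) (nc_word [])"
proof
  fix v
  show "sder t (nc_gen x) v = nc_scale (pair t x) (nc_word []) v"
  proof (cases v)
    case Nil
    then show ?thesis by (auto simp: nc_gen_def nc_word_def nc_scale_def pair_def)
  next
    case (Cons y u)
    have "(\<lambda>w. nc_gen x (y # w)) = (if x = y then nc_word [] else 0)"
      by (auto simp: nc_gen_def nc_word_def fun_eq_iff)
    then have "sder t (\<lambda>w. nc_gen x (y # w)) u = 0" by (simp add: sder_word_Nil sder_zero)
    then show ?thesis using Cons by (simp add: nc_gen_def nc_word_def nc_scale_def)
  qed
qed

lemma sder_word_Cons:
  "sder t (nc_word (x # w)) =
    nc_scale (pair t x) (nc_word (map (tr t) w)) + ncmul (nc_gen x) (sder t (nc_word w))"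
proof -
  have "nc_word (x # w) = ncmul (nc_gen x) (nc_word w)" by (simp add: nc_gen_def ncmul_words)
  then show ?thesis by (simp add: sder_ncmul sder_gen act_word ncmul_scale_left add.commute)
qed

text \<open>The pairing is nonzero only if x is t or its reversal, and both give the same
  transposition. Writing it in terms of x makes the derivative of a relation uniform in t.\<close>

lemma scale_pair_tr: "nc_scale (pair t x) (f (tr t y)) = nc_scale (pair t x) (f (tr x y))"
proof -
  consider "x = t" | "x = prod.swap t" | "pair t x = 0" by (cases "x = t"; cases "x = prod.swap t") (auto simp: pair_def)
  then show ?thesis
  proof cases
    case 2
    then have "tr x = tr t" by (auto simp: tr_def tri_def fun_eq_iff)
    then show ?thesis by simp
  qed (simp_all add: nc_scale_def)
qed

lemma sder_word2:
  "sder t (nc_word [x, y]) = nc_scale (pair t x) (nc_gen (tr x y)) + nc_scale (pair t y) (nc_gen x)"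
  using scale_pair_tr[of t x nc_gen y]
  by (simp add: sder_word_Cons sder_word_Nil ncmul_scale_right nc_gen_def del: nc.scale_cancel_left)

lemma act_add: "act t (p + q) = act t p + act t q" and act_diff: "act t (p - q) = act t p - act t q"
  by (simp_all add: act_def fun_eq_iff)

lemma act_gen: "act t (nc_gen x) = nc_gen (tr t x)"
  by (simp add: nc_gen_def act_word)

lemma tri_eq_iff [simp]: "tri t i = tri t j \<longleftrightarrow> i = j"
  by (auto simp: tri_def)

text \<open>The transposition may carry indices out of [n], so the bound is enlarged to cover a and
  b.\<close>

lemma act_fk_rels:
  assumes "0 < a" "0 < b" "r \<in> fk_rels n"
  shows "act (a, b) r \<in> fk_rels (n + a + b)"
proof -
  have *: "tri (a, b) i \<in> {1..n + a + b}" if "i \<in> {1..n}" for i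
    using that assms(1,2) by (auto simp: tri_def)
  have tr: "tr (a, b) (i, j) = (tri (a, b) i, tri (a, b) j)" for i j by (simp add: tr_def)
  note simps = act_add act_diff act_word act_gen list.map tr
  from assms(3) show ?thesis
  proof (cases rule: fk_rels_cases)
    case (anti i j)
    then show ?thesis by (simp only: simps) (intro fk_rels_intros *, simp_all)
  next
    case (sq i j)
    then show ?thesis by (simp only: simps) (intro fk_rels_intros *, simp_all)
  next
    case (comm i j k l)
    then show ?thesis by (simp only: simps) (intro fk_rels_intros *, simp_all)
  next
    case (triple i j k)
    then show ?thesis by (simp only: simps) (intro fk_rels_intros *, simp_all)
  qed
qed

text \<open>Antisymmetry relations vanish because the pairing is antisymmetric, commutators because
  each generator is fixed by the transposition of the other. Squares and triple relations yield
  multiples of x_ij + x_ji.\<close>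

lemma sder_fk_rels:
  assumes "a \<noteq> b" "r \<in> fk_rels n"
  shows "sder (a, b) r \<in> FK_ideal"
proof -
  have anti': "nc_gen (i, j) + nc_gen (j, i) \<in> FK_ideal" if "i \<in> {1..n}" "j \<in> {1..n}" "i \<noteq> j" for i j
    using that by (intro FK_ideal.base fk_rels_anti)
  note simps = sder_word2 sder_gen sder_add sder_diff
  from assms(2) show ?thesis
  proof (cases rule: fk_rels_cases)
    case (anti i j)
    have "sder (a, b) r = nc_scale (pair (a, b) (i, j) + pair (a, b) (j, i)) (nc_word [])"
      unfolding anti(1) simps by (simp add: nc_scale_def fun_eq_iff algebra_simps)
    also have "\<dots> = nc_scale 0 (nc_word [])" using pair_swap[of "(a, b)" "(i, j)"] by simp
    finally have "sder (a, b) r = 0" by (simp only: nc.scale_zero_left)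
    then show ?thesis by (simp only: FK_ideal.zero)
  next
    case (sq i j)
    have "sder (a, b) r = nc_scale (pair (a, b) (i, j)) (nc_gen (i, j) + nc_gen (j, i))"
      unfolding sq(1) simps by (simp add: tr_def tri_def fun_eq_iff nc_scale_def algebra_simps)
    then show ?thesis using FK_ideal_scale[OF anti'[OF sq(2,3,4)]] by (simp only:)
  next
    case (comm i j k l)
    have "sder (a, b) r = 0"
      unfolding comm(1) simps using comm(6) by (simp add: tr_def tri_def)
    then show ?thesis by (simp only: FK_ideal.zero)
  next
    case (triple i j k)
    have "sder (a, b) r = nc_scale (pair (a, b) (i, j)) (nc_gen (i, k) + nc_gen (k, i))
        + (nc_scale (pair (a, b) (j, k)) (nc_gen (j, i) + nc_gen (i, j))
        + nc_scale (pair (a, b) (k, i)) (nc_gen (k, j) + nc_gen (j, k)))"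
      unfolding triple(1) simps using triple(5)
      by (simp add: tr_def tri_def fun_eq_iff nc_scale_def algebra_simps)
    moreover have "\<dots> \<in> FK_ideal"
      by (intro FK_ideal.add FK_ideal_scale anti') (use triple in auto)
    ultimately show ?thesis by (simp only:)
  qed
qed

lemma act_FK_ideal: "p \<in> FK_ideal \<Longrightarrow> 0 < a \<Longrightarrow> 0 < b \<Longrightarrow> act (a, b) p \<in> FK_ideal"
proof (induction rule: FK_ideal.induct)
  case zero
  have "act (a, b) 0 = 0" by (simp add: act_def fun_eq_iff)
  then show ?case by (simp only: FK_ideal.zero)
next
  case (base r n)
  then show ?case using act_fk_rels FK_ideal.base by blast
next
  case (add p q)
  then show ?case unfolding act_add by (intro FK_ideal.add)
next
  case (lmul p q)
  then show ?case unfolding act_ncmul by (intro FK_ideal.lmul)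
next
  case (rmul p q)
  then show ?case unfolding act_ncmul by (intro FK_ideal.rmul)
qed

lemma sder_FK_ideal:
  "p \<in> FK_ideal \<Longrightarrow> 0 < a \<Longrightarrow> 0 < b \<Longrightarrow> a \<noteq> b \<Longrightarrow> sder (a, b) p \<in> FK_ideal"
proof (induction rule: FK_ideal.induct)
  case (base r n)
  then show ?case using sder_fk_rels by blast
next
  case zero
  show ?case unfolding sder_zero by (rule FK_ideal.zero)
next
  case (add p q)
  then show ?case unfolding sder_add by (intro FK_ideal.add)
next
  case (lmul p q)
  then show ?case unfolding sder_ncmul
    by (intro FK_ideal.add FK_ideal.lmul act_FK_ideal)
next
  case (rmul p q)
  then show ?case unfolding sder_ncmul
    by (intro FK_ideal.add FK_ideal.rmul)
qed

subsection \<open>Iterated derivations and linear independence\<close>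

definition dgen :: "nat \<Rightarrow> nat \<times> nat" where
  "dgen k = (par k, k)"

fun ders :: "(nat \<times> nat) list \<Rightarrow> (nat \<times> nat) nc \<Rightarrow> (nat \<times> nat) nc" where
  "ders [] p = p"
| "ders (t # T) p = ders T (sder t p)"

text \<open>The derivative of a single word as an explicit list of signed words, so that pairings
  can be evaluated by rewriting.\<close>

fun sdl :: "nat \<times> nat \<Rightarrow> (nat \<times> nat) list \<Rightarrow> (rat \<times> (nat \<times> nat) list) list" where
  "sdl t [] = []"
| "sdl t (x # w) = (if x = t then [(1, map (tr t) w)] else if x = prod.swap t then [(-1, map (tr t) w)]
    else []) @ map (\<lambda>(c, v). (c, x # v)) (sdl t w)"

text \<open>The constant left when a word is differentiated along all of \<open>T\<close>. It has
  this meaning only for words not longer than \<open>T\<close>; on longer words it is 0 by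
  convention.\<close>

fun pairing :: "(nat \<times> nat) list \<Rightarrow> (nat \<times> nat) list \<Rightarrow> rat" where
  "pairing [] w = (if w = [] then 1 else 0)"
| "pairing (t # T) w = (\<Sum>(c, v)\<leftarrow>sdl t w. c * pairing T v)"

lemma ders_add: "ders T (p + q) = ders T p + ders T q"
  by (induction T arbitrary: p q) (simp_all add: sder_add del: plus_fun_apply)

lemma ders_scale: "ders T (nc_scale c p) = nc_scale c (ders T p)"
  by (induction T arbitrary: p) (simp_all add: sder_scale)

lemma ders_zero: "ders T 0 = 0"
  by (induction T) (simp_all add: sder_zero del: zero_fun_apply)

lemma ders_sum: "ders T (sum f A) = (\<Sum>i\<in>A. ders T (f i))"
  by (induction A rule: infinite_finite_induct)
    (simp_all add: ders_add ders_zero del: plus_fun_apply zero_fun_apply)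

lemma ders_FK_ideal:
  "p \<in> FK_ideal \<Longrightarrow> \<forall>(a, b)\<in>set T. 0 < a \<and> 0 < b \<and> a \<noteq> b \<Longrightarrow> ders T p \<in> FK_ideal"
proof (induction T arbitrary: p)
  case (Cons t T)
  then show ?case using sder_FK_ideal[of p "fst t" "snd t"] by (auto split: prod.splits)
qed simp

lemma sdl_length: "(c, v) \<in> set (sdl t w) \<Longrightarrow> length w = Suc (length v)"
  by (induction w arbitrary: c v) (auto split: if_splits)

lemma sdl_none: "t \<notin> set w \<Longrightarrow> prod.swap t \<notin> set w \<Longrightarrow> sdl t w = []"
  by (induction w) auto

lemma sdl_append: "sdl t (A @ B) =
    map (\<lambda>(c, v). (c, v @ map (tr t) B)) (sdl t A) @ map (\<lambda>(c, v). (c, A @ v)) (sdl t B)"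
  by (induction A) (auto simp: case_prod_unfold)

lemma sder_word_sdl:
  "fst t \<noteq> snd t \<Longrightarrow> sder t (nc_word w) = (\<Sum>(c, v)\<leftarrow>sdl t w. nc_scale c (nc_word v))"
proof (induction w)
  case Nil
  then show ?case by (simp add: sder_word_Nil del: zero_fun_apply)
next
  case (Cons x w)
  have swap: "prod.swap t \<noteq> t" using Cons.prems by (metis fst_swap)
  have "ncmul (nc_gen x) (\<Sum>(c, v)\<leftarrow>l. nc_scale c (nc_word v))
      = (\<Sum>(c, v)\<leftarrow>map (\<lambda>(c, v). (c, x # v)) l. nc_scale c (nc_word v))" for l
    by (induction l) (auto simp: ncmul_add_right ncmul_scale_right nc_gen_def ncmul_words
        simp del: zero_fun_apply plus_fun_apply)
  then show ?case using Cons swap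
    by (auto simp: sder_word_Cons pair_def simp del: plus_fun_apply)
qed

lemma pairing_short: "length w < length T \<Longrightarrow> pairing T w = 0"
proof (induction T arbitrary: w)
  case (Cons t T)
  have "\<forall>(c, v)\<in>set (sdl t w). c * pairing T v = 0"
    using Cons by (auto dest!: sdl_length)
  moreover have "(\<Sum>(c, v)\<leftarrow>l. c * pairing T v) = 0" if "\<forall>(c, v)\<in>set l. c * pairing T v = 0" for l
    using that by (induction l) auto
  ultimately show ?case by simp
qed simp

lemma ders_word:
  "\<forall>t\<in>set T. fst t \<noteq> snd t \<Longrightarrow> length w \<le> length T \<Longrightarrow>
    ders T (nc_word w) = nc_scale (pairing T w) (nc_word [])"
proof (induction T arbitrary: w)
  case Nil
  then show ?case by simp
next
  case (Cons t T)
  have lin: "ders T (\<Sum>(c, v)\<leftarrow>l. nc_scale c (nc_word v))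
      = nc_scale (\<Sum>(c, v)\<leftarrow>l. c * pairing T v) (nc_word [])"
    if "\<forall>(c, v)\<in>set l. ders T (nc_word v) = nc_scale (pairing T v) (nc_word [])" for l
    using that by (induction l)
      (auto simp: ders_add ders_zero ders_scale nc.scale_left_distrib simp del: zero_fun_apply plus_fun_apply)
  have "\<forall>(c, v)\<in>set (sdl t w). ders T (nc_word v) = nc_scale (pairing T v) (nc_word [])"
    using Cons by (auto dest!: sdl_length)
  then show ?case using lin Cons.prems by (simp add: sder_word_sdl)
qed

text \<open>Every derivation in \<open>T\<close> annihilates \<open>u\<close>, so the second summand
  of the Leibniz rule disappears each time.\<close>

lemma ders_ncmul_left:
  assumes "\<And>w. u w \<noteq> 0 \<Longrightarrow> \<forall>t\<in>set T. t \<notin> set w \<and> prod.swap t \<notin> set w"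
  shows "ders T (ncmul u p) = ncmul u (ders T p)"
  using assms
proof (induction T arbitrary: p)
  case (Cons t T)
  have "sder t u = 0" by (rule sder_vanish) (use Cons.prems in auto)
  then have "sder t (ncmul u p) = ncmul u (sder t p)" by (simp add: sder_ncmul del: zero_fun_apply)
  then show ?case using Cons by simp
qed simp

text \<open>Descending induction on the length of r. The derivations dual to r annihilate shorter
  words and the other words of its length; coefficients of longer words are in the ideal by
  induction. What survives is a nonzero multiple of \<open>u r\<close>.\<close>

lemma dual_independent:
  assumes "finite R"
    and dual: "\<And>r. r \<in> R \<Longrightarrow> \<exists>T. (\<forall>(a, b)\<in>set T. 0 < a \<and> a < b \<and> b = m) \<and> length T = length r
      \<and> pairing T (map dgen r) \<noteq> 0 \<and> (\<forall>r'\<in>R. length r' = length r \<and> r' \<noteq> r \<longrightarrow> pairing T (map dgen r') = 0)"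
    and supp: "\<And>r w a b. r \<in> R \<Longrightarrow> u r w \<noteq> 0 \<Longrightarrow> (a, b) \<in> set w \<Longrightarrow> a \<noteq> m \<and> b \<noteq> m"
    and sum: "(\<Sum>r\<in>R. ncmul (u r) (nc_word (map dgen r))) \<in> FK_ideal"
    and "r \<in> R"
  shows "u r \<in> FK_ideal"
proof -
  define M where "M = Max (length ` R)"
  have "\<forall>r\<in>R. M - length r = d \<longrightarrow> u r \<in> FK_ideal" for d
  proof (induction d rule: less_induct)
    case (less d)
    show ?case
    proof (intro ballI impI)
      fix r assume r: "r \<in> R" "M - length r = d"
      obtain T where T: "\<forall>(a, b)\<in>set T. 0 < a \<and> a < b \<and> b = m" "length T = length r"
        "pairing T (map dgen r) \<noteq> 0" "\<forall>r'\<in>R. length r' = length r \<and> r' \<noteq> r \<longrightarrow> pairing T (map dgen r') = 0"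
        using dual[OF r(1)] by blast
      have ders: "ders T (ncmul (u r') p) = ncmul (u r') (ders T p)" if "r' \<in> R" for r' p
      proof (rule ders_ncmul_left)
        fix w assume w: "u r' w \<noteq> 0"
        show "\<forall>t\<in>set T. t \<notin> set w \<and> prod.swap t \<notin> set w"
          using T(1) supp[OF that w] by (fastforce simp: prod.swap_def)
      qed
      have vT: "\<forall>t\<in>set T. fst t \<noteq> snd t" using T(1) by auto
      have "ncmul (u r') (ders T (nc_word (map dgen r'))) \<in> FK_ideal" if "r' \<in> R - {r}" for r'
      proof (cases "length r' > length r")
        case True
        have "length r' \<le> M" using that \<open>finite R\<close> by (simp add: M_def)
        then have "M - length r' < d" using True r by linarith
        then have "u r' \<in> FK_ideal" using less that by blast
        then show ?thesis by (rule FK_ideal.rmul)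
      next
        case False
        then have "pairing T (map dgen r') = 0"
          using that T(2,4) pairing_short[of "map dgen r'" T] by (cases "length r' = length r") auto
        then have "ders T (nc_word (map dgen r')) = 0"
          using ders_word[OF vT, of "map dgen r'"] False T(2) by (simp del: zero_fun_apply)
        then show ?thesis by (simp add: FK_ideal.zero del: zero_fun_apply)
      qed
      then have rest: "(\<Sum>r'\<in>R - {r}. ncmul (u r') (ders T (nc_word (map dgen r')))) \<in> FK_ideal"
        by (intro nc.subspace_sum[OF FK_ideal_subspace])
      have "ders T (\<Sum>r\<in>R. ncmul (u r) (nc_word (map dgen r))) \<in> FK_ideal"
        by (rule ders_FK_ideal[OF sum]) (use T(1) in force)
      then have "(\<Sum>r'\<in>R. ncmul (u r') (ders T (nc_word (map dgen r')))) \<in> FK_ideal"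
        using ders by (simp add: ders_sum cong: sum.cong)
      from FK_ideal_diff[OF this rest] have "ncmul (u r) (ders T (nc_word (map dgen r))) \<in> FK_ideal"
        unfolding sum.remove[OF \<open>finite R\<close> r(1)] add_diff_cancel_right' .
      moreover have "ders T (nc_word (map dgen r)) = nc_scale (pairing T (map dgen r)) (nc_word [])"
        using ders_word[OF vT, of "map dgen r"] T(2) by simp
      ultimately have "nc_scale (pairing T (map dgen r)) (u r) \<in> FK_ideal" by (simp add: ncmul_scale_right)
      from FK_ideal_scale[OF this, of "1 / pairing T (map dgen r)"] T(3) show "u r \<in> FK_ideal" by simp
    qed
  qed
  then show ?thesis using \<open>r \<in> R\<close> by blast
qed

section \<open>Evaluation of the dual system\<close>

abbreviation tops :: "nat \<Rightarrow> nat list \<Rightarrow> (nat \<times> nat) list" where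
  "tops n I \<equiv> map (\<lambda>i. (i, n)) I"

lemma tr_pair [simp]: "tr t (i, j) = (tri t i, tri t j)"
  by (simp add: tr_def)

lemma pairing_first:
  assumes "\<And>x. x \<in> set w \<Longrightarrow> fst x \<noteq> n \<and> snd x \<noteq> n"
  shows "pairing ((i, n) # T) ((i, n) # w) = pairing T (map (tr (i, n)) w)"
proof -
  have "sdl (i, n) w = []" by (rule sdl_none) (use assms in force)+
  then show ?thesis by simp
qed

lemma map_tr_dgen_fixed:
  "\<forall>y\<in>set v. i \<noteq> y \<and> n \<noteq> y \<and> i \<noteq> par y \<and> n \<noteq> par y \<Longrightarrow> map (tr (i, n)) (map dgen v) = map dgen v"
  by (induction v) (simp_all add: dgen_def tri_def)

lemma map_tr_dgen_cons:
  "4 \<le> y \<Longrightarrow> y < n \<Longrightarrow> tr (y, n) (dgen y) = (par y, n)"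
  by (simp add: dgen_def tri_def par_def) arith

lemma down_Suc: "k \<le> Suc j \<Longrightarrow> down (Suc j) k = Suc j # down j k"
  by (simp add: down_def)

text \<open>Removing (j, n) interchanges j and n, so the next letter (par j, j) becomes (par j, n),
  exactly what the next derivation removes. The last interchange, of \<open>par k\<close> and n, is
  left acting on \<open>s\<close>.\<close>

lemma pairing_down:
  assumes "4 \<le> k" "k \<le> j" "j \<le> n" "set s \<subseteq> {2, 3}" "4 \<le> n"
  shows "pairing (tops n (map par (down j k) @ I)) ((par j, n) # map dgen (down (j - 1) k @ s))
    = pairing (tops n I) (map (tr (par k, n)) (map dgen s))"
  using assms(2,3)
proof (induction j rule: dec_induct)
  case base
  have "fst x \<noteq> n \<and> snd x \<noteq> n" if "x \<in> set (map dgen s)" for x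
    using that assms by (auto simp: dgen_def par_def split: if_splits)
  note first = pairing_first[of "map dgen s", OF this]
  have "down k k = [k]" "down (k - 1) k = []" using assms by (auto simp: down_def)
  then show ?case using first by (simp del: pairing.simps map_map)
next
  case (step j)
  have j: "4 \<le> j" "k \<le> j" "j < n" using step assms by auto
  have e: "down j k = j # down (j - 1) k" using down_split[of j k j] j by (simp add: down_empty)
  have par: "par (Suc j) = j" using j by (simp add: par_def)
  have "fst x \<noteq> n \<and> snd x \<noteq> n" if "x \<in> set (map dgen (down j k @ s))" for x
    using that assms j by (auto simp: dgen_def par_def split: if_splits)
  note first = pairing_first[of "map dgen (down j k @ s)", OF this]
  have fx: "map (tr (j, n)) (map dgen (down (j - 1) k @ s)) = map dgen (down (j - 1) k @ s)"
    by (rule map_tr_dgen_fixed) (use assms j in \<open>auto simp: par_def split: if_splits\<close>)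
  have "pairing (tops n (map par (down (Suc j) k) @ I)) ((par (Suc j), n) # map dgen (down j k @ s))
    = pairing (tops n (map par (down j k) @ I)) (map (tr (j, n)) (map dgen (down j k @ s)))"
    using first[of j] j by (simp add: down_Suc par del: pairing.simps)
  also have "map (tr (j, n)) (map dgen (down j k @ s)) = (par j, n) # map dgen (down (j - 1) k @ s)"
    using fx j by (simp add: e map_tr_dgen_cons)
  finally show ?case using step by simp
qed

lemma pairing_down_top:
  assumes "4 \<le> k" "k \<le> n" "set s \<subseteq> {2, 3}"
  shows "pairing (tops n (map par (down n k) @ I)) (map dgen (down n k @ s))
    = pairing (tops n I) (map (tr (par k, n)) (map dgen s))"
proof -
  have "down n k = n # down (n - 1) k" using down_split[of n k n] assms by (simp add: down_empty)
  then have "map dgen (down n k @ s) = (par n, n) # map dgen (down (n - 1) k @ s)"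
    by (simp add: dgen_def)
  then show ?thesis using pairing_down[of k n n s I] assms by (simp only:)
qed

text \<open>The words met when the derivations for (par j, n), j = n, n - 1, ..., are applied to the
  representative n ... 4 2 3 2 4 ... k.\<close>

definition ret :: "nat \<Rightarrow> nat \<Rightarrow> nat \<Rightarrow> (nat \<times> nat) list" where
  "ret n k j = (if k < j then map dgen [4..<Suc k]
    else map dgen [4..<j] @ (par j, n) # (if j = k then [] else (n, j) # map dgen [Suc j..<k]))"

text \<open>The descent is consumed as in \<open>pairing_down\<close>, while the same transposition
  carries the ascending tail from \<open>ret n k (Suc j)\<close> to \<open>ret n k j\<close>. If j <
  k, the tail holds a second copy of (j, n), and the contribution of removing that copy has to be
  shown to vanish.\<close>

lemma pairing_return_step:
  assumes "4 \<le> k" "k \<le> n" "4 \<le> j" "j < n"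
  shows "pairing (tops n (map par (down (Suc j) 4) @ I))
      ((par (Suc j), n) # map dgen (down j 4 @ [2, 3, 2]) @ ret n k (Suc j))
    = pairing (tops n (map par (down j 4) @ I))
      ((par j, n) # map dgen (down (j - 1) 4 @ [2, 3, 2]) @ ret n k j)"
proof -
  let ?W = "map dgen (down (j - 1) 4 @ [2, 3, 2])"
  have e: "down j 4 = j # down (j - 1) 4" using down_split[of j 4 j] assms by (simp add: down_empty)
  have par: "par (Suc j) = j" using assms by (simp add: par_def)
  have fx: "map (tr (j, n)) ?W = ?W"
    by (rule map_tr_dgen_fixed) (use assms in \<open>auto simp: par_def split: if_splits\<close>)
  have W: "fst x \<noteq> n \<and> snd x \<noteq> n" if "x \<in> set (map dgen (down j 4 @ [2, 3, 2]))" for x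
    using that assms by (auto simp: dgen_def par_def split: if_splits)
  have main: "map (tr (j, n)) (map dgen (down j 4 @ [2, 3, 2])) = (par j, n) # ?W"
    using fx assms by (simp add: e map_tr_dgen_cons)
  have fix4: "map (tr (j, n)) (map dgen [4..<j]) = map dgen [4..<j]"
    by (rule map_tr_dgen_fixed) (use assms in \<open>auto simp: par_def split: if_splits\<close>)
  have tl: "tops n (map par (down (Suc j) 4) @ I) = (j, n) # tops n (map par (down j 4) @ I)"
    using assms by (simp add: down_Suc par)
  show ?thesis
  proof (cases "k \<le> j")
    case True
    have n: "fst x \<noteq> n \<and> snd x \<noteq> n"
      if "x \<in> set (map dgen (down j 4 @ [2, 3, 2]) @ map dgen [4..<Suc k])" for x
      using that assms True by (auto simp: dgen_def par_def split: if_splits)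
    have "map (tr (j, n)) (map dgen [4..<Suc k]) = ret n k j"
    proof (cases "k = j")
      case True
      then have "[4..<Suc k] = [4..<j] @ [j]" using assms by simp
      then show ?thesis using True fix4 assms by (simp add: ret_def map_tr_dgen_cons)
    next
      case False
      have "map (tr (j, n)) (map dgen [4..<Suc k]) = map dgen [4..<Suc k]"
        by (rule map_tr_dgen_fixed) (use assms True False in \<open>auto simp: par_def split: if_splits\<close>)
      then show ?thesis using True False by (simp add: ret_def)
    qed
    moreover have "ret n k (Suc j) = map dgen [4..<Suc k]" using True by (simp add: ret_def)
    ultimately show ?thesis unfolding tl par
      using pairing_first[of "map dgen (down j 4 @ [2, 3, 2]) @ map dgen [4..<Suc k]", OF n] main
      by (simp only: map_append append_Cons)
  next
    case False
    define V where "V = (if Suc j = k then [] else (n, Suc j) # map dgen [Suc (Suc j)..<k])"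
    have r1: "ret n k (Suc j) = map dgen [4..<Suc j] @ (j, n) # V"
      using False by (simp add: ret_def V_def par)
    have V: "map (tr (j, n)) V = map dgen [Suc j..<k]"
    proof (cases "Suc j = k")
      case False
      have "map (tr (j, n)) (map dgen [Suc (Suc j)..<k]) = map dgen [Suc (Suc j)..<k]"
        by (rule map_tr_dgen_fixed) (use assms in \<open>auto simp: par_def split: if_splits\<close>)
      moreover have "tr (j, n) (n, Suc j) = dgen (Suc j)"
        using assms False \<open>\<not> k \<le> j\<close> par by (simp add: tri_def dgen_def)
      moreover have "[Suc j..<k] = Suc j # [Suc (Suc j)..<k]"
        using False \<open>\<not> k \<le> j\<close> by (simp add: upt_conv_Cons)
      ultimately show ?thesis using False by (simp add: V_def)
    qed (simp add: V_def)
    define A where "A = map dgen (down j 4 @ [2, 3, 2]) @ map dgen [4..<Suc j]"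
    have nA: "fst x \<noteq> n \<and> snd x \<noteq> n" if "x \<in> set A" for x
      using that assms by (auto simp: A_def dgen_def par_def split: if_splits)
    have sA: "sdl (i, n) A = []" for i by (rule sdl_none) (use nA in force)+
    have sV: "sdl (j, n) V = []"
      by (rule sdl_none) (use assms False in \<open>auto simp: V_def dgen_def par_def split: if_splits\<close>)
    have nV: "fst x \<noteq> n \<and> snd x \<noteq> n" if "x \<in> set (map dgen [Suc j..<k])" for x
      using that assms by (auto simp: dgen_def par_def split: if_splits)
    have sV': "sdl (i, n) (map dgen [Suc j..<k]) = []" for i
      by (rule sdl_none) (use nV in force)+
    have ret: "map (tr (j, n)) (map dgen [4..<Suc j] @ (j, n) # V) = ret n k j"
    proof -
      have "[4..<Suc j] = [4..<j] @ [j]" using assms by simp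
      then show ?thesis using fix4 assms False V
        by (simp add: ret_def map_tr_dgen_cons tri_def)
    qed
    have "par j < j" using assms by (simp add: par_def)
    \<comment> \<open>If the copy in the tail is removed, the leading (j, n) stays behind as the
      only letter involving n, and it does not match the next derivation (par j, n).\<close>
    then have dead: "pairing (tops n (map par (down j 4) @ I)) ((j, n) # A @ map dgen [Suc j..<k]) = 0"
      using assms by (simp add: e sdl_append sA sV')
    have "pairing ((j, n) # T) ((j, n) # A @ (j, n) # V)
        = pairing T (map (tr (j, n)) (A @ (j, n) # V)) + pairing T ((j, n) # A @ map (tr (j, n)) V)" for T
      by (simp add: sdl_append sA sV)
    moreover have "map (tr (j, n)) (A @ (j, n) # V) = (par j, n) # ?W @ ret n k j"
      using main ret by (simp add: A_def)
    ultimately show ?thesis unfolding tl par r1 using dead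
      by (simp only: A_def V append_assoc append_Cons add_0_right)
  qed
qed

text \<open>Removing (n, j) contributes -1 and interchanges j and n, which turns the next letter (j,
  j+1) into (n, j+1). The pairing is thus a product of signs.\<close>

lemma pairing_tail:
  "4 \<le> j \<Longrightarrow> j \<le> k \<Longrightarrow> k \<le> n \<Longrightarrow>
    pairing (tops n [j..<k]) (if j = k then [] else (n, j) # map dgen [Suc j..<k]) \<noteq> 0"
proof (induction "k - j" arbitrary: j)
  case (Suc d)
  then have jk: "j < k" by simp
  have e: "[j..<k] = j # [Suc j..<k]" using jk by (simp add: upt_conv_Cons)
  have "sdl (j, n) (map dgen [Suc j..<k]) = []"
    by (rule sdl_none) (use Suc.prems in \<open>auto simp: dgen_def par_def split: if_splits\<close>)
  moreover have "map (tr (j, n)) (map dgen [Suc j..<k])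
    = (if Suc j = k then [] else (n, Suc j) # map dgen [Suc (Suc j)..<k])"
  proof (cases "Suc j = k")
    case False
    then have "[Suc j..<k] = Suc j # [Suc (Suc j)..<k]" using jk by (simp add: upt_conv_Cons)
    moreover have "map (tr (j, n)) (map dgen [Suc (Suc j)..<k]) = map dgen [Suc (Suc j)..<k]"
      by (rule map_tr_dgen_fixed) (use Suc.prems in \<open>auto simp: par_def split: if_splits\<close>)
    moreover have "tr (j, n) (dgen (Suc j)) = (n, Suc j)"
      using Suc.prems False jk by (simp add: dgen_def par_def tri_def)
    ultimately show ?thesis using False by simp
  qed simp
  moreover have "pairing (tops n [Suc j..<k]) (if Suc j = k then [] else (n, Suc j) # map dgen [Suc (Suc j)..<k]) \<noteq> 0"
    using Suc.hyps(1)[of "Suc j"] Suc.hyps(2) Suc.prems jk by simp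
  ultimately show ?case using jk Suc.prems by (simp add: e)
qed simp

text \<open>The derivations are matched to the word: the parents for the descent, 2, 3, 2 for the
  middle, 1 for the letter (1, n) at the head of \<open>ret n k 4\<close>, and 4, ..., k - 1 for
  what is left of the ascent.\<close>

lemma pairing_return:
  assumes "4 \<le> k" "k \<le> n"
  shows "pairing (tops n (map par (down n 4) @ [2, 3, 2, 1] @ [4..<k]))
    (map dgen (down n 4 @ [2, 3, 2] @ [4..<Suc k])) \<noteq> 0"
proof -
  let ?I = "[2, 3, 2, 1] @ [4..<k]"
  have n: "4 \<le> n" using assms by simp
  have it: "pairing (tops n (map par (down j 4) @ ?I)) ((par j, n) # map dgen (down (j - 1) 4 @ [2, 3, 2]) @ ret n k j)
    = pairing (tops n (1 # ?I)) ((1, n) # map dgen [2, 3, 2] @ ret n k 4)" if "4 \<le> j" "j \<le> n" for j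
    using that
  proof (induction j rule: dec_induct)
    case base
    show ?case by (simp add: down_def par_def del: pairing.simps)
  next
    case (step j)
    then show ?case using pairing_return_step[OF assms, of j ?I] by (simp del: pairing.simps)
  qed
  have dn: "down n 4 = n # down (n - 1) 4" using down_split[of n 4 n] n by (simp add: down_empty)
  define F where "F = (if 4 = k then [] else (n, 4) # map dgen [5..<k])"
  have retn: "ret n k n = map dgen [4..<Suc k]" if "k = n"
  proof -
    have "[4..<Suc k] = [4..<k] @ [k]" using assms by simp
    then show ?thesis using that by (simp add: ret_def dgen_def)
  qed
  have "ret n k n = map dgen [4..<Suc k]"
    using assms retn by (cases "k = n") (auto simp: ret_def)
  then have "map dgen (down n 4 @ [2, 3, 2] @ [4..<Suc k])
      = (par n, n) # map dgen (down (n - 1) 4 @ [2, 3, 2]) @ ret n k n"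
    unfolding dn by (simp add: dgen_def[of n])
  moreover have "ret n k 4 = (1, n) # F"
    using assms by (simp add: ret_def F_def par_def)
  ultimately have "pairing (tops n (map par (down n 4) @ ?I)) (map dgen (down n 4 @ [2, 3, 2] @ [4..<Suc k]))
    = pairing (tops n (1 # ?I)) ((1, n) # map dgen [2, 3, 2] @ (1, n) # F)"
    using it[of n] n by (simp only:)
  \<comment> \<open>A single branch survives. After the leading (1, n) is removed, 2, 3, 2 strip the
    middle letters from right to left; the tail letter (1, n), by then (n, 1), goes last, and its
    transposition restores \<open>F\<close>. The four signs multiply to 1.\<close>
  also have "\<dots> = pairing (tops n [4..<k]) F"
  proof -
    define C where "C = map dgen [4..<k]"
    have C: "sdl (i, n) C = []" for i
      by (rule sdl_none) (use assms in \<open>auto simp: C_def dgen_def par_def split: if_splits\<close>)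
    have CF: "map (tr (1, n)) F = C" "map (tr (1, n)) C = F" "sdl (1, n) F = []"
    proof -
      consider "k = 4" | "[4..<k] = 4 # [5..<k]" "k \<noteq> 4"
        using assms upt_conv_Cons[of 4 k] by (cases "k = 4") auto
      then have "map (tr (1, n)) F = C \<and> map (tr (1, n)) C = F \<and> sdl (1, n) F = []"
      proof cases
        case 2
        have "map (tr (1, n)) (map dgen [5..<k]) = map dgen [5..<k]"
          by (rule map_tr_dgen_fixed) (use assms in \<open>auto simp: par_def split: if_splits\<close>)
        moreover have "sdl (1, n) ((n, 4) # map dgen [5..<k]) = []"
          by (rule sdl_none) (use assms in \<open>auto simp: dgen_def par_def split: if_splits\<close>)
        moreover have "tr (1, n) (n, 4) = dgen 4" "tr (1, n) (dgen 4) = (n, 4)"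
          using assms 2 by (auto simp: tri_def dgen_def par_def)
        ultimately show ?thesis using 2 by (simp add: F_def C_def)
      qed (simp add: F_def C_def)
      then show "map (tr (1, n)) F = C" "map (tr (1, n)) C = F" "sdl (1, n) F = []" by auto
    qed
    have C23: "map (tr (2, n)) C = C" "map (tr (3, n)) C = C"
      unfolding C_def by (rule map_tr_dgen_fixed; use assms in \<open>auto simp: par_def split: if_splits\<close>)+
    have g: "dgen 2 = (1, 2)" "dgen 3 = (1, 3)" by (simp_all add: dgen_def par_def)
    show ?thesis
      using n by (simp add: g sdl_append C CF C23 tri_def del: map_map One_nat_def)
  qed
  also have "\<dots> \<noteq> 0" using pairing_tail[of 4 k n] assms by (auto simp: F_def)
  finally show ?thesis .
qed

lemma finite_reps: "finite (reps m)"
  by (simp add: reps_def)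

lemma set_reps: "r \<in> reps m \<Longrightarrow> set r \<subseteq> {2..m}"
proof (cases "4 \<le> m")
  case True
  assume "r \<in> reps m"
  from this True show ?thesis by (cases rule: reps_cases) (use True in auto)
qed (auto simp: reps_def split: if_splits)

lemma length_down [simp]: "length (down m k) = Suc m - k"
  by (auto simp: down_def)

lemma hd_reps: "r \<in> reps m \<Longrightarrow> r \<noteq> [] \<Longrightarrow> hd r = m"
proof (cases "4 \<le> m")
  case True
  assume a: "r \<in> reps m" "r \<noteq> []"
  have "hd (down m k @ s) = m" if "k \<le> m" for k s using that by (simp add: down_def)
  note hd = this
  from a(1) True show ?thesis
  proof (cases rule: reps_cases)
    case (down k)
    then show ?thesis using a(2) hd[of k "[]"] by (cases "k = Suc m") (auto simp: down_empty)
  qed (use hd[of 4] True in auto)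
qed (auto simp: reps_def split: if_splits)

text \<open>Where a word is determined by its length, a nonzero pairing is enough. For m at least 4
  only the middle words of lengths m - 2 and m - 1 need derivations that separate two
  candidates.\<close>

lemma reps_dual:
  assumes "r \<in> reps m"
  shows "\<exists>T. (\<forall>(a, b)\<in>set T. 0 < a \<and> a < b \<and> b = m) \<and> length T = length r
    \<and> pairing T (map dgen r) \<noteq> 0
    \<and> (\<forall>r'\<in>reps m. length r' = length r \<and> r' \<noteq> r \<longrightarrow> pairing T (map dgen r') = 0)"
proof -
  have ex: ?thesis if "set I \<subseteq> {1..<m}" "length I = length r" "pairing (tops m I) (map dgen r) \<noteq> 0"
      "\<forall>r'\<in>reps m. length r' = length r \<and> r' \<noteq> r \<longrightarrow> pairing (tops m I) (map dgen r') = 0" for I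
    by (rule exI[of _ "tops m I"]) (use that in auto)
  show ?thesis
  proof (cases "4 \<le> m")
    case False
    then consider "m \<le> 1" | "m = 2" | "m = 3" by linarith
    then show ?thesis
    proof cases
      case 1
      then show ?thesis using assms by (intro ex[of "[]"]) (auto simp: reps_def)
    next
      case 2
      then consider "r = []" | "r = [2]" using assms by (auto simp: reps_def)
      then show ?thesis
        by cases (rule ex[of "[]"] ex[of "[1]"]; auto simp: reps_def 2 dgen_def par_def)+
    next
      case 3
      then consider "r = []" | "r = [3]" | "r = [3, 2]" using assms by (auto simp: reps_def)
      then show ?thesis
        by cases (rule ex[of "[]"] ex[of "[1]"] ex[of "[1, 2]"];
            auto simp: reps_def 3 dgen_def par_def tri_def)+
    qed
  next
    case m: True
    have pars: "set (map par (down m k)) \<subseteq> {1..<m}" if "4 \<le> k" for k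
      using that by (auto simp: par_def)
    from assms m show ?thesis
    proof (cases rule: reps_cases)
      case (down k)
      show ?thesis
      proof (rule ex[of "map par (down m k)"])
        show "pairing (tops m (map par (down m k))) (map dgen r) \<noteq> 0"
        proof (cases "k = Suc m")
          case False
          then show ?thesis using pairing_down_top[of k m "[]" "[]"] down by simp
        qed (simp add: down down_empty)
        have "r' = r" if "r' \<in> reps m" "length r' = length r" for r'
          using that(1) m
        proof (cases rule: reps_cases)
          case (down k')
          then have "k' = k" using that(2) \<open>k \<in> {4..Suc m}\<close> \<open>r = down m k\<close> by auto
          then show ?thesis using down \<open>r = down m k\<close> by simp
        qed (use that(2) down m in auto)
        then show "\<forall>r'\<in>reps m. length r' = length r \<and> r' \<noteq> r \<longrightarrow>
            pairing (tops m (map par (down m k))) (map dgen r') = 0" by blast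
      qed (use pars down in auto)
    next
      case (middle s)
      have g: "pairing (tops m (map par (down m 4) @ I)) (map dgen (down m 4 @ s))
          = pairing (tops m I) (map (tr (1, m)) (map dgen s))" if "set s \<subseteq> {2, 3}" for I s
        using pairing_down_top[of 4 m s I] m that by (simp add: par_def)
      have d: "dgen 2 = (1, 2)" "dgen 3 = (1, 3)" by (simp_all add: dgen_def par_def)
      \<comment> \<open>\<open>J\<close> is \<open>s\<close> reversed. After the descent the middle
        letters read (m, 2) and (m, 3); removing the first of two distinct ones turns the other into
        (2, 3) or (3, 2), out of reach of further derivations, so letters must be removed from the
        right.\<close>
      define J where "J = (if s = [2, 3] then [3, 2] else if s = [3, 2] then [2, 3] else s)"
      have J: "set J \<subseteq> {2, 3}" "length J = length s" using middle by (auto simp: J_def)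
      show ?thesis
      proof (rule ex[of "map par (down m 4) @ J"])
        show "pairing (tops m (map par (down m 4) @ J)) (map dgen r) \<noteq> 0"
        proof -
          consider "s = [2]" | "s = [3]" | "s = [2, 3]" | "s = [3, 2]" | "s = [2, 3, 2]"
            using middle(1) by auto
          then show ?thesis unfolding middle(2) using m
            by cases (subst g; simp add: J_def d tri_def del: One_nat_def)+
        qed
        have s': "\<exists>s'. r' = down m 4 @ s' \<and> s' \<in> {[2], [3], [2, 3], [3, 2], [2, 3, 2]} \<and> length s' = length s \<and> s' \<noteq> s"
          if "r' \<in> reps m" "length r' = length r" "r' \<noteq> r" for r'
          using that(1) m that(2,3) middle by (cases rule: reps_cases) auto
        show "\<forall>r'\<in>reps m. length r' = length r \<and> r' \<noteq> r \<longrightarrow>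
            pairing (tops m (map par (down m 4) @ J)) (map dgen r') = 0"
        proof (intro ballI impI)
          fix r' assume "r' \<in> reps m" "length r' = length r \<and> r' \<noteq> r"
          then obtain s' where s': "r' = down m 4 @ s'" "s' \<in> {[2], [3], [2, 3], [3, 2], [2, 3, 2]}"
            "length s' = length s" "s' \<noteq> s"
            using s' by blast
          show "pairing (tops m (map par (down m 4) @ J)) (map dgen r') = 0"
          proof -
            consider "s = [2]" "s' = [3]" | "s = [3]" "s' = [2]" | "s = [2, 3]" "s' = [3, 2]"
              | "s = [3, 2]" "s' = [2, 3]" using s'(2,3,4) middle(1) by auto
            then show ?thesis unfolding s'(1) using m
              by cases (subst g; simp add: J_def d tri_def del: One_nat_def)+
          qed
        qed
      qed (use pars[of 4] J middle m in auto)
    next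
      case (return k)
      show ?thesis
      proof (rule ex[of "map par (down m 4) @ [2, 3, 2, 1] @ [4..<k]"])
        show "pairing (tops m (map par (down m 4) @ [2, 3, 2, 1] @ [4..<k])) (map dgen r) \<noteq> 0"
          unfolding return(2) by (rule pairing_return) (use return in auto)
        have "r' = r" if "r' \<in> reps m" "length r' = length r" for r'
          using that(1) m
        proof (cases rule: reps_cases)
          case (return k')
          then have "k' = k" using that(2) \<open>k \<in> {4..m}\<close> \<open>r = _\<close> by auto
          then show ?thesis using return \<open>r = _\<close> by simp
        qed (use that(2) return m in auto)
        then show "\<forall>r'\<in>reps m. length r' = length r \<and> r' \<noteq> r \<longrightarrow>
            pairing (tops m (map par (down m 4) @ [2, 3, 2, 1] @ [4..<k])) (map dgen r') = 0" by blast
      qed (use pars[of 4] return m in auto)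
    qed
  qed
qed

section \<open>Independence of the basis words\<close>

lemma set_basis_words: "b \<in> basis_words m \<Longrightarrow> set b \<subseteq> {2..m}"
proof (induction m arbitrary: b)
  case (Suc m)
  then obtain u r where "b = u @ r" "u \<in> basis_words m" "r \<in> reps (Suc m)" by auto
  then show ?case using Suc.IH[of u] set_reps[of r "Suc m"] by auto
qed simp

lemma basis_words_Suc: "basis_words (Suc m) = (\<lambda>(u, r). u @ r) ` (basis_words m \<times> reps (Suc m))"
  by auto

lemma finite_basis_words: "finite (basis_words m)"
  by (induction m) (simp_all add: basis_words_Suc finite_reps del: basis_words.simps(2))

text \<open>The seam can be recovered: the letters of \<open>u\<close> are at most m, whereas a
  nonempty \<open>r\<close> starts with \<open>Suc m\<close>.\<close>

lemma inj_basis_words: "inj_on (\<lambda>(u, r). u @ r) (basis_words m \<times> reps (Suc m))"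
proof (rule inj_onI, clarify)
  fix u r u' r' assume a: "u \<in> basis_words m" "r \<in> reps (Suc m)" "u' \<in> basis_words m"
    "r' \<in> reps (Suc m)" "u @ r = u' @ r'"
  have "takeWhile (\<lambda>x. x \<noteq> Suc m) (v @ s) = v" if "v \<in> basis_words m" "s \<in> reps (Suc m)" for v s
  proof -
    have "\<forall>x\<in>set v. x \<noteq> Suc m" using set_basis_words[OF that(1)] by auto
    then show ?thesis using hd_reps[OF that(2)] by (cases s) (auto simp: takeWhile_append)
  qed
  from this[OF a(1,2)] this[OF a(3,4)] a(5) show "u = u' \<and> r = r'" by auto
qed

lemma sum_basis_words_Suc:
  "(\<Sum>b\<in>basis_words (Suc m). f b) = (\<Sum>r\<in>reps (Suc m). \<Sum>u\<in>basis_words m. f (u @ r))"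
proof -
  have "(\<Sum>b\<in>basis_words (Suc m). f b) = (\<Sum>(u, r)\<in>basis_words m \<times> reps (Suc m). f (u @ r))"
    unfolding basis_words_Suc using inj_basis_words
    by (subst sum.reindex) (auto simp: case_prod_unfold)
  also have "\<dots> = (\<Sum>u\<in>basis_words m. \<Sum>r\<in>reps (Suc m). f (u @ r))"
    by (simp add: sum.cartesian_product)
  finally show ?thesis by (subst sum.swap)
qed

text \<open>The sum is grouped by its last factor r. The coefficient \<open>U r\<close> involves
  only indices up to m, so derivations in the index \<open>Suc m\<close> isolate it. The induction
  ends at the empty word, since elements of the ideal have no constant term.\<close>

lemma basis_words_independent:
  "(\<Sum>b\<in>basis_words m. nc_scale (c b) (nc_word (map dgen b))) \<in> FK_ideal \<Longrightarrow> b \<in> basis_words m \<Longrightarrow> c b = 0"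
proof (induction m arbitrary: c b)
  case 0
  then show ?case using FK_ideal_Nil[of "nc_scale (c []) (nc_word [])"]
    by (simp add: nc_scale_def nc_word_def)
next
  case (Suc m)
  define U where "U r = (\<Sum>u\<in>basis_words m. nc_scale (c (u @ r)) (nc_word (map dgen u)))" for r
  have "(\<Sum>b\<in>basis_words (Suc m). nc_scale (c b) (nc_word (map dgen b)))
      = (\<Sum>r\<in>reps (Suc m). ncmul (U r) (nc_word (map dgen r)))"
    unfolding sum_basis_words_Suc U_def ncmul_sum_left
    by (intro sum.cong refl) (simp add: ncmul_scale_left ncmul_words)
  with Suc.prems(1) have sum: "(\<Sum>r\<in>reps (Suc m). ncmul (U r) (nc_word (map dgen r))) \<in> FK_ideal"
    by (simp only:)
  have supp: "i \<noteq> Suc m \<and> j \<noteq> Suc m" if nz: "U r w \<noteq> 0" and mem: "(i, j) \<in> set w" for r w i j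
  proof -
    obtain u where u: "u \<in> basis_words m" "nc_scale (c (u @ r)) (nc_word (map dgen u)) w \<noteq> 0"
      by (rule sum.not_neutral_contains_not_neutral[OF nz[unfolded U_def sum_fun_apply]])
    then have "w = map dgen u" by (simp add: nc_scale_def nc_word_def split: if_splits)
    with mem set_basis_words[OF u(1)] show ?thesis
      by (force simp: dgen_def par_def split: if_splits)
  qed
  obtain u r where b: "b = u @ r" "u \<in> basis_words m" "r \<in> reps (Suc m)" using Suc.prems(2) by auto
  have "U r \<in> FK_ideal"
    by (rule dual_independent[OF finite_reps reps_dual supp sum b(3)])
  from Suc.IH[OF this[unfolded U_def] b(2)] b(1) show ?case by simp
qed

section \<open>Counting basis words by length\<close>

lemma qint_Suc: "qint (Suc k) = qint k + monom 1 k"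
  by (simp add: qint_def)

lemma qint_add: "qint (j + k) = qint j + monom 1 j * qint k"
  by (induction k) (simp_all add: qint_Suc qint_def[of 0] distrib_left mult_monom add_ac)

lemma sum_reps:
  assumes "4 \<le> m"
  shows "(\<Sum>r\<in>reps m. monom (1 :: nat) (length r)) = qint m * (1 + monom 1 (m - 2))"
proof -
  define p where "p = m - 4"
  have m: "m = p + 4" using assms by (simp add: p_def)
  define A where "A = (\<lambda>k. down m k) ` {4..Suc m}"
  define B where "B = (\<lambda>s. down m 4 @ s) ` {[2], [3], [2, 3], [3, 2], [2, 3, 2]}"
  define C where "C = (\<lambda>k. down m 4 @ [2, 3, 2] @ [4..<Suc k]) ` {4..m}"
  let ?f = "\<lambda>r :: nat list. monom (1 :: nat) (length r)"
  have fin: "finite A" "finite B" "finite C" by (simp_all add: A_def B_def C_def)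
  have R: "reps m = (A \<union> B) \<union> C" using assms by (simp add: reps_def A_def B_def C_def)
  have "length r \<le> m - 3" if "r \<in> A" for r using that m by (auto simp: A_def)
  moreover have lB: "m - 3 < length r \<and> length r \<le> m" if "r \<in> B" for r using that m by (auto simp: B_def)
  moreover have "m < length r" if "r \<in> C" for r using that m by (auto simp: C_def)
  ultimately have disj: "A \<inter> B = {}" "(A \<union> B) \<inter> C = {}" by fastforce+
  have "sum ?f A = (\<Sum>k\<in>{4..Suc m}. monom 1 (Suc m - k))"
    unfolding A_def
    by (subst sum.reindex, rule inj_on_inverseI[of _ "\<lambda>r. Suc m - length r"]) auto
  also have "\<dots> = qint (m - 2)"
    unfolding qint_def by (rule sum.reindex_bij_witness[of _ "\<lambda>i. Suc m - i" "\<lambda>k. Suc m - k"]) (use m in auto)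
  finally have sA: "sum ?f A = qint (p + 2)" by (simp add: m)
  have sB: "sum ?f B = monom 1 (p + 2) + monom 1 (p + 2) + (monom 1 (p + 3) + monom 1 (p + 3)) + monom 1 (p + 4)"
    unfolding B_def by (subst sum.reindex) (auto intro!: inj_onI simp: m numeral_eq_Suc add_ac)
  have "sum ?f C = (\<Sum>k\<in>{4..m}. monom 1 (m + k - 3))"
    unfolding C_def using m
    by (subst sum.reindex, intro inj_on_inverseI[of _ "\<lambda>r. length r + 3 - m"])
      (auto intro!: sum.cong arg_cong[of _ _ "monom (Suc 0)"])
  also have "\<dots> = (\<Sum>i<m - 3. monom 1 (m + 1 + i))"
    by (rule sum.reindex_bij_witness[of _ "\<lambda>i. i + 4" "\<lambda>k. k - 4"]) (use m in auto)
  also have "\<dots> = monom 1 (p + 5) * qint (p + 1)"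
    by (simp add: qint_def sum_distrib_left mult_monom m add_ac del: sum.lessThan_Suc)
  finally have sC: "sum ?f C = monom 1 (p + 5) * qint (p + 1)" .
  have "sum ?f (reps m) = sum ?f A + sum ?f B + sum ?f C"
    unfolding R using fin disj by (simp add: sum.union_disjoint)
  \<comment> \<open>Of the two words of each doubled length m - 2 and m - 1, one completes
    \<open>qint m\<close> and the other starts its copy shifted by m - 2.\<close>
  also have "\<dots> = (qint (p + 2) + monom 1 (p + 2) + monom 1 (p + 3))
      + monom 1 (p + 2) * (1 + monom 1 1 + monom 1 2 + monom 1 3 * qint (p + 1))"
    unfolding sA sB sC
    by (simp add: algebra_simps mult_monom mult.assoc[symmetric] numeral_eq_Suc)
  also have "qint (p + 2) + monom 1 (p + 2) + monom 1 (p + 3) = qint m"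
    using qint_Suc[of "p + 2"] qint_Suc[of "p + 3"] by (simp add: m numeral_eq_Suc)
  also have "1 + monom 1 1 + monom 1 2 + monom 1 3 * qint (p + 1) = qint m"
  proof -
    have "qint 3 = 1 + monom 1 1 + monom 1 2"
      by (simp add: qint_def numeral_eq_Suc del: One_nat_def) simp
    moreover have "m = 3 + (p + 1)" by (simp add: m)
    ultimately show ?thesis by (simp only: qint_add)
  qed
  finally show ?thesis using m by (simp add: algebra_simps)
qed

lemma sum_basis_words_Suc_monom:
  "(\<Sum>b\<in>basis_words (Suc m). monom (1 :: nat) (length b))
    = (\<Sum>b\<in>basis_words m. monom 1 (length b)) * (\<Sum>r\<in>reps (Suc m). monom 1 (length r))"
  unfolding sum_basis_words_Suc
  by (subst mult.commute) (simp add: sum_product mult_monom add.commute)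

text \<open>Passing from m to m + 1 multiplies by [m+1] (1 + t^(m-1)). The old factor [m-1] combines
  with 1 + t^(m-1) to [2m-2], the new factor of the product, and [m+1] [m] remains in front. At 3
  the product is empty.\<close>

lemma sum_basis_words:
  assumes "3 \<le> n"
  shows "(\<Sum>b\<in>basis_words n. monom (1 :: nat) (length b))
    = qint n * qint (n - 1) * (\<Prod>k\<in>{2..n - 2}. qint (2 * k))"
  using assms
proof (induction n rule: dec_induct)
  case base
  have "(\<Sum>b\<in>basis_words 3. monom (1 :: nat) (length b)) = qint 2 * qint 3"
    unfolding numeral_3_eq_3 sum_basis_words_Suc_monom
    by (simp add: reps_def qint_def numeral_eq_Suc add_ac del: One_nat_def)
  then show ?case by (simp add: mult.commute)
next
  case (step m)
  have "qint (2 * (m - 1)) = qint (m - 1) * (1 + monom 1 (m - 1))"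
    unfolding mult_2 qint_add by (simp only: distrib_left mult_1_left mult_1_right mult.commute)
  moreover have "{2..Suc m - 2} = insert (m - 1) {2..m - 2}" using step.hyps by auto
  moreover have "m - 1 \<notin> {2..m - 2}" using step.hyps by auto
  ultimately have "(\<Prod>k\<in>{2..Suc m - 2}. qint (2 * k))
      = qint (m - 1) * (1 + monom 1 (m - 1)) * (\<Prod>k\<in>{2..m - 2}. qint (2 * k))"
    by (simp only: prod.insert[OF finite_atLeastAtMost] simp_thms)
  then show ?case
    unfolding sum_basis_words_Suc_monom step.IH using step.hyps sum_reps[of "Suc m"]
    by (simp add: mult_ac)
qed

subsection \<open>Braid and claw relations\<close>

lemma fk_ideal_word_context:
  assumes "p \<in> fk_ideal n" "set u \<subseteq> fk_gens n" "set v \<subseteq> fk_gens n"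
  shows "ncmul (nc_word u) (ncmul p (nc_word v)) \<in> fk_ideal n"
  using assms unfolding fk_ideal_def by (rule ideal_gen_context)

text \<open>The triple relation with the letters at j oriented outwards: x_ab x_ja = x_ja x_jb +
  x_jb x_ab. It moves the outer letter x_ab across the star at j, the mechanism behind the braid and
  claw relations.\<close>

lemma fk_triple_star:
  assumes "j \<in> {1..n}" "a \<in> {1..n}" "b \<in> {1..n}" "distinct [j, a, b]"
  shows "nc_word [(a, b), (j, a)] - nc_word [(j, a), (j, b)] - nc_word [(j, b), (a, b)] \<in> fk_ideal n"
    (is "?p \<in> _")
proof -
  have base: "r \<in> fk_ideal n" if "r \<in> fk_rels n" for r
    using that unfolding fk_ideal_def by (rule ideal_gen.base)
  have anti: "nc_word [(x, y)] + nc_word [(y, x)] \<in> fk_ideal n"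
    if "x \<in> {1..n}" "y \<in> {1..n}" "x \<noteq> y" for x y
    using base[OF fk_rels_anti[OF that]] by (simp add: nc_gen_def)
  have swap: "nc_word [(x, y), z] + nc_word [(y, x), z] \<in> fk_ideal n"
    "nc_word [z, (x, y)] + nc_word [z, (y, x)] \<in> fk_ideal n"
    if "x \<in> {1..n}" "y \<in> {1..n}" "x \<noteq> y" "z \<in> fk_gens n" for x y z
    using fk_ideal_word_context[OF anti[OF that(1-3)], of "[]" "[z]"]
      fk_ideal_word_context[OF anti[OF that(1-3)], of "[z]" "[]"] that(4)
    by (simp_all add: ncmul_add_left ncmul_add_right ncmul_words)
  have T: "nc_word [(a, j), (j, b)] + nc_word [(j, b), (b, a)] + nc_word [(b, a), (a, j)] \<in> fk_ideal n"
    by (rule base, rule fk_rels_triple) (use assms in auto)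
  have 1: "nc_word [(a, j), (j, b)] + nc_word [(j, a), (j, b)] \<in> fk_ideal n"
    by (rule swap) (use assms in \<open>auto simp: fk_gens_def\<close>)
  have 2: "nc_word [(j, b), (b, a)] + nc_word [(j, b), (a, b)] \<in> fk_ideal n"
    by (rule swap) (use assms in \<open>auto simp: fk_gens_def\<close>)
  have 3: "nc_word [(b, a), (a, j)] + nc_word [(a, b), (a, j)] \<in> fk_ideal n"
    by (rule swap) (use assms in \<open>auto simp: fk_gens_def\<close>)
  have 4: "nc_word [(a, b), (a, j)] + nc_word [(a, b), (j, a)] \<in> fk_ideal n"
    by (rule swap) (use assms in \<open>auto simp: fk_gens_def\<close>)
  have "?p = (nc_word [(a, j), (j, b)] + nc_word [(j, b), (b, a)] + nc_word [(b, a), (a, j)])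
      - (nc_word [(a, j), (j, b)] + nc_word [(j, a), (j, b)])
      - (nc_word [(j, b), (b, a)] + nc_word [(j, b), (a, b)])
      - (nc_word [(b, a), (a, j)] + nc_word [(a, b), (a, j)])
      + (nc_word [(a, b), (a, j)] + nc_word [(a, b), (j, a)])"
    by (simp add: algebra_simps)
  also have "\<dots> \<in> fk_ideal n"
    using T 1 2 3 4 unfolding fk_ideal_def by - (assumption | rule ideal_gen.add ideal_gen_diff)+
  finally show ?thesis .
qed

text \<open>With E = x_ab, moving E twice gives E A A = A B A + B E A = A B A + B A B + B B E, and
  both squares vanish.\<close>

lemma fk_braid:
  assumes "j \<in> {1..n}" "a \<in> {1..n}" "b \<in> {1..n}" "distinct [j, a, b]"
  shows "nc_word [(j, a), (j, b), (j, a)] + nc_word [(j, b), (j, a), (j, b)] \<in> fk_ideal n" (is "?p \<in> _")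
proof -
  define A B E where "A = (j, a)" and "B = (j, b)" and "E = (a, b)"
  have g: "A \<in> fk_gens n" "B \<in> fk_gens n" "E \<in> fk_gens n"
    using assms by (auto simp: A_def B_def E_def fk_gens_def)
  have sq: "nc_word [x, x] \<in> fk_ideal n" if "x \<in> {A, B}" for x
    using that fk_rels_sq[of j n a] fk_rels_sq[of j n b] assms unfolding fk_ideal_def
    by (auto simp: A_def B_def intro: ideal_gen.base)
  have S: "nc_word [E, A] - nc_word [A, B] - nc_word [B, E] \<in> fk_ideal n"
    using fk_triple_star[OF assms] by (simp add: A_def B_def E_def)
  note ctx = fk_ideal_word_context
  have 1: "nc_word [E, A, A] - nc_word [A, B, A] - nc_word [B, E, A] \<in> fk_ideal n"
    using ctx[OF S, of "[]" "[A]"] g by (simp add: ncmul_diff_left ncmul_diff_right ncmul_words)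
  have 2: "nc_word [B, E, A] - nc_word [B, A, B] - nc_word [B, B, E] \<in> fk_ideal n"
    using ctx[OF S, of "[B]" "[]"] g by (simp add: ncmul_diff_left ncmul_diff_right ncmul_words)
  have 3: "nc_word [E, A, A] \<in> fk_ideal n" "nc_word [B, B, E] \<in> fk_ideal n"
    using ctx[OF sq, of A "[E]" "[]"] ctx[OF sq, of B "[]" "[E]"] g by (simp_all add: ncmul_words)
  have "?p = nc_word [E, A, A] - nc_word [B, B, E]
      - (nc_word [E, A, A] - nc_word [A, B, A] - nc_word [B, E, A])
      - (nc_word [B, E, A] - nc_word [B, A, B] - nc_word [B, B, E])"
    by (simp add: A_def B_def)
  also have "\<dots> \<in> fk_ideal n" using 1 2 3 unfolding fk_ideal_def by - (assumption | rule ideal_gen_diff)+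
  finally show ?thesis .
qed

text \<open>Summing the identity below over the three cyclic rotations and comparing with the expansion of
  the claw element S itself gives S = - 2 S.\<close>

lemma fk_claw_half:
  assumes "j \<in> {1..n}" "a \<in> {1..n}" "b \<in> {1..n}" "c \<in> {1..n}" "distinct [j, a, b, c]"
  defines "A \<equiv> (j, a)" and "B \<equiv> (j, b)" and "C \<equiv> (j, c)" and "F \<equiv> (b, c)"
  shows "nc_word [A, B, C, A] - nc_word [F, A, B, A] + nc_word [A, C, A, F] \<in> fk_ideal n"
    and "nc_word [F, B, A, B] - nc_word [B, C, A, B] - nc_word [C, A, B, C] - nc_word [C, A, C, F] \<in> fk_ideal n"
proof -
  have g: "A \<in> fk_gens n" "B \<in> fk_gens n" "C \<in> fk_gens n" "F \<in> fk_gens n"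
    using assms by (auto simp: fk_gens_def)
  have S: "nc_word [F, B] - nc_word [B, C] - nc_word [C, F] \<in> fk_ideal n"
    unfolding B_def C_def F_def by (rule fk_triple_star) (use assms in auto)
  have K: "nc_word [A, F] - nc_word [F, A] \<in> fk_ideal n"
    unfolding fk_ideal_def A_def F_def
    by (rule ideal_gen.base, rule fk_rels_comm) (use assms in auto)
  have S': "nc_word (u @ [F, B] @ v) - nc_word (u @ [B, C] @ v) - nc_word (u @ [C, F] @ v) \<in> fk_ideal n"
    if "set u \<subseteq> fk_gens n" "set v \<subseteq> fk_gens n" for u v
    using fk_ideal_word_context[OF S that] by (simp add: ncmul_diff_left ncmul_diff_right ncmul_words)
  have K': "nc_word (u @ [A, F] @ v) - nc_word (u @ [F, A] @ v) \<in> fk_ideal n"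
    if "set u \<subseteq> fk_gens n" "set v \<subseteq> fk_gens n" for u v
    using fk_ideal_word_context[OF K that] by (simp add: ncmul_diff_left ncmul_diff_right ncmul_words)
  have 1: "nc_word [A, F, B, A] - nc_word [A, B, C, A] - nc_word [A, C, F, A] \<in> fk_ideal n"
    "nc_word [A, F, B, A] - nc_word [F, A, B, A] \<in> fk_ideal n"
    "nc_word [A, C, A, F] - nc_word [A, C, F, A] \<in> fk_ideal n"
    using S'[of "[A]" "[A]"] K'[of "[]" "[B, A]"] K'[of "[A, C]" "[]"] g by simp_all
  have "nc_word [A, B, C, A] - nc_word [F, A, B, A] + nc_word [A, C, A, F]
      = (nc_word [A, F, B, A] - nc_word [F, A, B, A])
      - (nc_word [A, F, B, A] - nc_word [A, B, C, A] - nc_word [A, C, F, A])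
      + (nc_word [A, C, A, F] - nc_word [A, C, F, A])"
    by simp
  also have "\<dots> \<in> fk_ideal n"
    using 1 unfolding fk_ideal_def by - (assumption | rule ideal_gen.add ideal_gen_diff)+
  finally show "nc_word [A, B, C, A] - nc_word [F, A, B, A] + nc_word [A, C, A, F] \<in> fk_ideal n" .
  have 2: "nc_word [F, B, A, B] - nc_word [B, C, A, B] - nc_word [C, F, A, B] \<in> fk_ideal n"
    "nc_word [C, A, F, B] - nc_word [C, F, A, B] \<in> fk_ideal n"
    "nc_word [C, A, F, B] - nc_word [C, A, B, C] - nc_word [C, A, C, F] \<in> fk_ideal n"
    using S'[of "[]" "[A, B]"] K'[of "[C]" "[B]"] S'[of "[C, A]" "[]"] g by simp_all
  have "nc_word [F, B, A, B] - nc_word [B, C, A, B] - nc_word [C, A, B, C] - nc_word [C, A, C, F]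
      = (nc_word [F, B, A, B] - nc_word [B, C, A, B] - nc_word [C, F, A, B])
      - (nc_word [C, A, F, B] - nc_word [C, F, A, B])
      + (nc_word [C, A, F, B] - nc_word [C, A, B, C] - nc_word [C, A, C, F])"
    by simp
  also have "\<dots> \<in> fk_ideal n"
    using 2 unfolding fk_ideal_def by - (assumption | rule ideal_gen.add ideal_gen_diff)+
  finally show "nc_word [F, B, A, B] - nc_word [B, C, A, B] - nc_word [C, A, B, C] - nc_word [C, A, C, F]
    \<in> fk_ideal n" .
qed

text \<open>Braid relations multiplied by an outer edge \<open>E\<close>, \<open>F\<close> or
  \<open>G\<close> cancel all terms outside the claw element. What remains is three times that
  element, and 3 is invertible over the rationals.\<close>

lemma fk_claw:
  assumes "j \<in> {1..n}" "a \<in> {1..n}" "b \<in> {1..n}" "c \<in> {1..n}" "distinct [j, a, b, c]"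
  shows "nc_word [(j, a), (j, b), (j, c), (j, a)] + nc_word [(j, b), (j, c), (j, a), (j, b)]
    + nc_word [(j, c), (j, a), (j, b), (j, c)] \<in> fk_ideal n" (is "?p \<in> _")
proof -
  define A B C E F G where "A = (j, a)" and "B = (j, b)" and "C = (j, c)"
    and "E = (a, b)" and "F = (b, c)" and "G = (c, a)"
  note d = A_def B_def C_def E_def F_def G_def
  have g: "A \<in> fk_gens n" "B \<in> fk_gens n" "C \<in> fk_gens n" "E \<in> fk_gens n" "F \<in> fk_gens n" "G \<in> fk_gens n"
    using assms by (auto simp: d fk_gens_def)
  have abc: "nc_word [A, B, C, A] - nc_word [F, A, B, A] + nc_word [A, C, A, F] \<in> fk_ideal n"
    "nc_word [F, B, A, B] - nc_word [B, C, A, B] - nc_word [C, A, B, C] - nc_word [C, A, C, F] \<in> fk_ideal n"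
    using fk_claw_half[of j n a b c] assms unfolding d by auto
  have bca: "nc_word [B, C, A, B] - nc_word [G, B, C, B] + nc_word [B, A, B, G] \<in> fk_ideal n"
    "nc_word [G, C, B, C] - nc_word [C, A, B, C] - nc_word [A, B, C, A] - nc_word [A, B, A, G] \<in> fk_ideal n"
    using fk_claw_half[of j n b c a] assms unfolding d by auto
  have cab: "nc_word [C, A, B, C] - nc_word [E, C, A, C] + nc_word [C, B, C, E] \<in> fk_ideal n"
    "nc_word [E, A, C, A] - nc_word [A, B, C, A] - nc_word [B, C, A, B] - nc_word [B, C, B, E] \<in> fk_ideal n"
    using fk_claw_half[of j n c a b] assms unfolding d by auto
  have br: "nc_word [A, B, A] + nc_word [B, A, B] \<in> fk_ideal n" "nc_word [B, C, B] + nc_word [C, B, C] \<in> fk_ideal n"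
    "nc_word [C, A, C] + nc_word [A, C, A] \<in> fk_ideal n"
    using fk_braid[of j n a b] fk_braid[of j n b c] fk_braid[of j n c a] assms unfolding d by auto
  have brl: "nc_word [z, x, y, x] + nc_word [z, y, x, y] \<in> fk_ideal n"
    and brr: "nc_word [x, y, x, z] + nc_word [y, x, y, z] \<in> fk_ideal n"
    if "nc_word [x, y, x] + nc_word [y, x, y] \<in> fk_ideal n" "z \<in> fk_gens n" for x y z
    using fk_ideal_word_context[OF that(1), of "[z]" "[]"] fk_ideal_word_context[OF that(1), of "[]" "[z]"] that(2)
    by (simp_all add: ncmul_add_left ncmul_add_right ncmul_words)
  have "nc_scale 3 ?p =
        (nc_word [A, B, C, A] - nc_word [F, A, B, A] + nc_word [A, C, A, F])
      + (nc_word [B, C, A, B] - nc_word [G, B, C, B] + nc_word [B, A, B, G])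
      + (nc_word [C, A, B, C] - nc_word [E, C, A, C] + nc_word [C, B, C, E])
      - (nc_word [F, B, A, B] - nc_word [B, C, A, B] - nc_word [C, A, B, C] - nc_word [C, A, C, F])
      - (nc_word [G, C, B, C] - nc_word [C, A, B, C] - nc_word [A, B, C, A] - nc_word [A, B, A, G])
      - (nc_word [E, A, C, A] - nc_word [A, B, C, A] - nc_word [B, C, A, B] - nc_word [B, C, B, E])
      + (nc_word [F, A, B, A] + nc_word [F, B, A, B])
      + (nc_word [G, B, C, B] + nc_word [G, C, B, C])
      + (nc_word [E, C, A, C] + nc_word [E, A, C, A])
      - (nc_word [A, B, A, G] + nc_word [B, A, B, G])
      - (nc_word [B, C, B, E] + nc_word [C, B, C, E])
      - (nc_word [C, A, C, F] + nc_word [A, C, A, F])"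
    by (simp add: fun_eq_iff nc_scale_def d algebra_simps)
  also have "\<dots> \<in> fk_ideal n"
    using abc bca cab brl[OF br(1) g(5)] brl[OF br(2) g(6)] brl[OF br(3) g(4)]
      brr[OF br(1) g(6)] brr[OF br(2) g(4)] brr[OF br(3) g(5)]
    unfolding fk_ideal_def by - (assumption | rule ideal_gen.add ideal_gen_diff)+
  finally have "nc_scale (1 / 3) (nc_scale 3 ?p) \<in> fk_ideal n"
    unfolding fk_ideal_def by (rule ideal_gen_scale)
  then show ?thesis by simp
qed

subsection \<open>The free algebra on the edges\<close>

lemma nc_map_word: "nc_map f (nc_word w) = nc_word (map f w)"
proof
  fix v
  have "{u. map f u = v \<and> nc_word w u \<noteq> 0} = (if map f w = v then {w} else {})"
    by (auto simp: nc_word_def)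
  then show "nc_map f (nc_word w) v = nc_word (map f w) v"
    by (simp add: nc_map_def) (auto simp: nc_word_def)
qed

lemma edge_gen_edge: "i < j \<Longrightarrow> edge_gen {i, j} = (i, j)"
  by (simp add: edge_gen_def)

definition sg :: "nat \<Rightarrow> nat \<Rightarrow> rat" where
  "sg j a = (if j < a then 1 else -1)"

lemma Xs_eq: "Xs j a = nc_scale (sg j a) (nc_word [{j, a}])"
  by (auto simp: Xs_def sg_def nc_gen_def nc_scale_def fun_eq_iff)

lemma sg_square: "sg j a * sg j a = 1"
  by (simp add: sg_def)

locale graph =
  fixes n :: nat and E :: "nat set set"
  assumes edges: "e \<in> E \<Longrightarrow> \<exists>i j. e = {i, j} \<and> i < j \<and> i \<in> {1..n} \<and> j \<in> {1..n}"
begin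

lemma edgeD: "{i, j} \<in> E \<Longrightarrow> i \<noteq> j \<and> i \<in> {1..n} \<and> j \<in> {1..n}"
  using edges[of "{i, j}"] by (auto simp: doubleton_eq_iff)

lemma edge_gen_inverse: "e \<in> E \<Longrightarrow> (\<lambda>(i, j). {i, j}) (edge_gen e) = e"
  using edges[of e] by (auto simp: edge_gen_edge)

lemma edge_gen_in: "e \<in> E \<Longrightarrow> edge_gen e \<in> fk_gens n"
  using edges[of e] by (auto simp: edge_gen_edge fk_gens_def)

text \<open>\<open>edge_gen\<close> is injective on edges, with \<open>(i, j)\<close> sent to
  \<open>{i, j}\<close> as inverse, so the sum over preimages has at most one term. Linearity and
  multiplicativity are read off from this pointwise formula.\<close>

lemma nc_map_eq:
  assumes "p \<in> falg E"
  shows "nc_map edge_gen p = (\<lambda>v. if \<forall>x\<in>set v. edge_gen ((\<lambda>(i, j). {i, j}) x) = x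
    then p (map (\<lambda>(i, j). {i, j}) v) else 0)"
proof
  fix v
  let ?h = "\<lambda>(i, j). {i, j :: nat}"
  have w: "w = map ?h v" if "map edge_gen w = v" "p w \<noteq> 0" for w
  proof -
    have "set w \<subseteq> E" using assms that by (simp add: falg_def)
    then have "map ?h (map edge_gen w) = w" using edge_gen_inverse by (auto intro!: map_idI)
    then show ?thesis using that by simp
  qed
  show "nc_map edge_gen p v = (if \<forall>x\<in>set v. edge_gen (?h x) = x then p (map ?h v) else 0)"
  proof (cases "\<forall>x\<in>set v. edge_gen (?h x) = x")
    case True
    then have "map edge_gen (map ?h v) = v" unfolding map_map by (intro map_idI) simp
    then have "{w. map edge_gen w = v \<and> p w \<noteq> 0} = {w. w = map ?h v \<and> p w \<noteq> 0}"
      using w by blast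
    moreover have "sum p {w. w = a \<and> p w \<noteq> 0} = p a" for a
      by (cases "p a = 0") (auto intro: sum.neutral cong: conj_cong)
    ultimately show ?thesis using True by (simp add: nc_map_def)
  next
    case False
    have "{w. map edge_gen w = v \<and> p w \<noteq> 0} = {}"
    proof (rule ccontr)
      assume "{w. map edge_gen w = v \<and> p w \<noteq> 0} \<noteq> {}"
      then obtain w where w': "map edge_gen w = v" "p w \<noteq> 0" by blast
      from w[OF this] w'(1) have "map (edge_gen \<circ> ?h) v = v" by simp
      then have "map (edge_gen \<circ> ?h) v = map (\<lambda>x. x) v" by simp
      then show False using False unfolding map_eq_conv by simp
    qed
    then show ?thesis unfolding nc_map_def if_not_P[OF False] by (simp only: sum.empty)
  qed
qed

lemma nc_map_add: "p \<in> falg E \<Longrightarrow> q \<in> falg E \<Longrightarrow>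
    nc_map edge_gen (p + q) = nc_map edge_gen p + nc_map edge_gen q"
  by (simp add: nc_map_eq falg_add fun_eq_iff)

lemma nc_map_scale: "p \<in> falg E \<Longrightarrow> nc_map edge_gen (nc_scale c p) = nc_scale c (nc_map edge_gen p)"
  by (simp add: nc_map_eq falg_scale) (simp add: nc_scale_def fun_eq_iff)

lemma nc_map_zero: "nc_map edge_gen 0 = 0"
  unfolding nc_map_eq[OF falg_zero] by (simp add: fun_eq_iff)

lemma nc_map_diff: "p \<in> falg E \<Longrightarrow> q \<in> falg E \<Longrightarrow>
    nc_map edge_gen (p - q) = nc_map edge_gen p - nc_map edge_gen q"
  by (simp add: nc_map_eq falg_diff fun_eq_iff)

lemma nc_map_mul:
  assumes "p \<in> falg E" "q \<in> falg E"
  shows "nc_map edge_gen (ncmul p q) = ncmul (nc_map edge_gen p) (nc_map edge_gen q)"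
proof
  fix v
  let ?ok = "\<lambda>v. \<forall>x\<in>set v. edge_gen ((\<lambda>(i, j). {i, j}) x) = x"
  have "?ok v \<longleftrightarrow> ?ok (take i v) \<and> ?ok (drop i v)" for i
    by (metis Un_iff append_take_drop_id set_append)
  note ok = this
  show "nc_map edge_gen (ncmul p q) v = ncmul (nc_map edge_gen p) (nc_map edge_gen q) v"
  proof (cases "?ok v")
    case True
    then have "?ok (take i v)" "?ok (drop i v)" for i using ok[of i] by blast+
    then show ?thesis
      unfolding ncmul_def[of "nc_map edge_gen p"] nc_map_eq[OF falg_mul[OF assms]] nc_map_eq[OF assms(1)]
        nc_map_eq[OF assms(2)] using True by (simp add: ncmul_def take_map drop_map)
  next
    case False
    then have "\<not> ?ok (take i v) \<or> \<not> ?ok (drop i v)" for i using ok[of i] by blast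
    moreover have "nc_map edge_gen r w = 0" if "r \<in> falg E" "\<not> ?ok w" for r w
      unfolding nc_map_eq[OF that(1)] if_not_P[OF that(2)] ..
    ultimately have "nc_map edge_gen p (take i v) = 0 \<or> nc_map edge_gen q (drop i v) = 0" for i
      using assms by blast
    then have "nc_map edge_gen p (take i v) * nc_map edge_gen q (drop i v) = 0" for i
      by simp
    then have "(\<Sum>i\<le>length v. nc_map edge_gen p (take i v) * nc_map edge_gen q (drop i v)) = 0"
      by (intro sum.neutral ballI)
    then show ?thesis
      unfolding ncmul_def[of "nc_map edge_gen p"] nc_map_eq[OF falg_mul[OF assms]] if_not_P[OF False] by simp
  qed
qed

lemma nc_map_sum_words:
  assumes "finite B" "\<And>b. b \<in> B \<Longrightarrow> set (f b) \<subseteq> E"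
  shows "nc_map edge_gen (\<Sum>b\<in>B. nc_scale (c b) (nc_word (f b)))
    = (\<Sum>b\<in>B. nc_scale (c b) (nc_word (map edge_gen (f b))))"
  using assms
proof (induction B rule: finite_induct)
  case empty
  show ?case by (simp add: nc_map_zero del: zero_fun_apply)
next
  case (insert b B)
  have 1: "nc_scale (c b) (nc_word (f b)) \<in> falg E"
    and 2: "(\<Sum>b\<in>B. nc_scale (c b) (nc_word (f b))) \<in> falg E"
    using insert.prems by (auto intro!: nc.subspace_sum[OF falg_subspace] falg_scale falg_word)
  have "nc_map edge_gen (\<Sum>b\<in>insert b B. nc_scale (c b) (nc_word (f b)))
    = nc_map edge_gen (nc_scale (c b) (nc_word (f b)) + (\<Sum>b\<in>B. nc_scale (c b) (nc_word (f b))))"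
    using insert.hyps by (simp del: plus_fun_apply)
  also have "\<dots> = nc_scale (c b) (nc_word (map edge_gen (f b)))
      + (\<Sum>b\<in>B. nc_scale (c b) (nc_word (map edge_gen (f b))))"
    using nc_map_add[OF 1 2] insert.IH insert.prems
    by (simp add: nc_map_scale falg_word nc_map_word del: plus_fun_apply)
  finally show ?case using insert.hyps by (simp del: plus_fun_apply)
qed

subsection \<open>The graph relations hold in the Fomin--Kirillov algebra\<close>

lemma falg_Xs: "{j, a} \<in> E \<Longrightarrow> Xs j a \<in> falg E"
  by (simp add: Xs_eq falg_scale falg_word)

lemma nc_map_ncprod: "set ps \<subseteq> falg E \<Longrightarrow> nc_map edge_gen (ncprod ps) = ncprod (map (nc_map edge_gen) ps)"
proof (induction ps)
  case (Cons p ps)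
  then have "ncprod ps \<in> falg E" by (simp add: falg_ncprod)
  then show ?case using Cons nc_map_mul[of p "ncprod ps"] by (simp add: ncprod_def)
qed (simp add: ncprod_def nc_map_word)

text \<open>\<open>edge_gen\<close> always gives the pair (Min, Max). For a < j the sign in
  \<open>Xs j a\<close> compensates for this through x_ja = -x_aj, which holds only modulo the
  ideal.\<close>

lemma nc_map_Xs_prod:
  assumes "\<forall>a\<in>set as. {j, a} \<in> E"
  shows "nc_map edge_gen (ncprod (map (Xs j) as)) - nc_word (map (Pair j) as) \<in> fk_ideal n"
proof -
  have gen: "nc_map edge_gen (Xs j a) \<in> falg (fk_gens n) \<and> nc_word [(j, a)] \<in> falg (fk_gens n)
      \<and> nc_map edge_gen (Xs j a) - nc_word [(j, a)] \<in> fk_ideal n" if "a \<in> set as" for a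
  proof -
    have e: "{j, a} \<in> E" using assms that by simp
    have m: "nc_map edge_gen (Xs j a) = nc_scale (sg j a) (nc_word [edge_gen {j, a}])"
      using e by (simp add: Xs_eq nc_map_scale falg_word nc_map_word)
    have "nc_map edge_gen (Xs j a) - nc_word [(j, a)] \<in> fk_ideal n"
    proof (cases "j < a")
      case True
      then have "nc_map edge_gen (Xs j a) - nc_word [(j, a)] = 0"
        unfolding m by (simp add: sg_def edge_gen_edge del: zero_fun_apply)
      then show ?thesis unfolding fk_ideal_def by (simp only: ideal_gen.zero)
    next
      case False
      then have "edge_gen {j, a} = (a, j)"
        using edge_gen_edge[of a j] edgeD[OF e] by (simp add: insert_commute)
      then have "nc_map edge_gen (Xs j a) - nc_word [(j, a)] = - (nc_gen (j, a) + nc_gen (a, j))"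
        unfolding m using False by (simp add: sg_def nc_gen_def nc_scale_def fun_eq_iff)
      moreover have "nc_gen (j, a) + nc_gen (a, j) \<in> fk_ideal n"
        unfolding fk_ideal_def using edgeD[OF e] by (intro ideal_gen.base fk_rels_anti) auto
      ultimately show ?thesis unfolding fk_ideal_def by (simp only: ideal_gen_neg)
    qed
    moreover have "nc_map edge_gen (Xs j a) \<in> falg (fk_gens n)"
      unfolding m using edge_gen_in[OF e] by (intro falg_scale falg_word) auto
    moreover have "nc_word [(j, a)] \<in> falg (fk_gens n)"
      using edgeD[OF e] by (intro falg_word) (auto simp: fk_gens_def)
    ultimately show ?thesis by blast
  qed
  have "nc_map edge_gen (ncprod (map (Xs j) as)) = ncprod (map (\<lambda>a. nc_map edge_gen (Xs j a)) as)"
    using assms by (subst nc_map_ncprod) (auto simp: falg_Xs comp_def)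
  moreover have "ncprod (map (\<lambda>a. nc_word [(j, a)]) as) = nc_word (map (Pair j) as)"
    by (induction as) (simp_all add: ncprod_def ncmul_words)
  moreover have "ncprod (map (\<lambda>a. nc_map edge_gen (Xs j a)) as) - ncprod (map (\<lambda>a. nc_word [(j, a)]) as) \<in> fk_ideal n"
    unfolding fk_ideal_def
    by (rule ncprod_cong_ideal) (use gen in \<open>auto simp: list_all2_conv_all_nth fk_ideal_def\<close>)
  ultimately show ?thesis by simp
qed

lemma graph_rels_kernel:
  assumes "r \<in> graph_rels E"
  shows "r \<in> fk_kernel n E"
proof -
  have fX: "ncprod (map (Xs j) as) \<in> falg E" if "\<forall>a\<in>set as. {j, a} \<in> E" for j as
    using that by (intro falg_ncprod) (auto simp: falg_Xs)
  have diff: "p \<in> fk_ideal n" if "q \<in> fk_ideal n" "p - q \<in> fk_ideal n" for p q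
    using ideal_gen.add[OF that[unfolded fk_ideal_def]] by (simp add: fk_ideal_def)
  have add: "p \<in> fk_ideal n \<Longrightarrow> q \<in> fk_ideal n \<Longrightarrow> p + q \<in> fk_ideal n" for p q
    unfolding fk_ideal_def by (rule ideal_gen.add)
  from assms consider
      (sq) e where "r = nc_word [e, e]" "e \<in> E"
    | (comm) e f where "r = nc_word [e, f] - nc_word [f, e]" "e \<in> E" "f \<in> E" "e \<inter> f = {}"
    | (braid) j a b where "r = ncprod (map (Xs j) [a, b, a]) + ncprod (map (Xs j) [b, a, b])"
        "{j, a} \<in> E" "{j, b} \<in> E" "a \<noteq> b"
    | (claw) j a b c where "r = ncprod (map (Xs j) [a, b, c, a]) + ncprod (map (Xs j) [b, c, a, b])
        + ncprod (map (Xs j) [c, a, b, c])" "{j, a} \<in> E" "{j, b} \<in> E" "{j, c} \<in> E" "distinct [a, b, c]"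
    unfolding graph_rels_def nc_gens_mul list.map by blast
  then show ?thesis
  proof cases
    case sq
    obtain i j where "e = {i, j}" "i < j" "i \<in> {1..n}" "j \<in> {1..n}" using edges[OF sq(2)] by blast
    then have "nc_word [edge_gen e, edge_gen e] \<in> fk_ideal n"
      unfolding fk_ideal_def by (intro ideal_gen.base) (simp add: edge_gen_edge fk_rels_sq)
    then show ?thesis using sq by (simp add: fk_kernel_def falg_word nc_map_word)
  next
    case comm
    obtain i j where e: "e = {i, j}" "i < j" "i \<in> {1..n}" "j \<in> {1..n}" using edges[OF comm(2)] by blast
    obtain k l where f: "f = {k, l}" "k < l" "k \<in> {1..n}" "l \<in> {1..n}" using edges[OF comm(3)] by blast
    have "nc_word [edge_gen e, edge_gen f] - nc_word [edge_gen f, edge_gen e] \<in> fk_ideal n"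
      unfolding fk_ideal_def e f edge_gen_edge[OF e(2)] edge_gen_edge[OF f(2)]
      by (intro ideal_gen.base fk_rels_comm) (use e f comm(4) in auto)
    then show ?thesis using comm by (simp add: fk_kernel_def falg_word falg_diff nc_map_word nc_map_diff)
  next
    case braid
    have i: "j \<in> {1..n}" "a \<in> {1..n}" "b \<in> {1..n}" "distinct [j, a, b]"
      using edgeD[OF braid(2)] edgeD[OF braid(3)] braid(4) by auto
    have f: "ncprod (map (Xs j) [a, b, a]) \<in> falg E" "ncprod (map (Xs j) [b, a, b]) \<in> falg E"
      by (rule fX; use braid in simp)+
    have "nc_map edge_gen r - (nc_word (map (Pair j) [a, b, a]) + nc_word (map (Pair j) [b, a, b]))
      = (nc_map edge_gen (ncprod (map (Xs j) [a, b, a])) - nc_word (map (Pair j) [a, b, a]))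
      + (nc_map edge_gen (ncprod (map (Xs j) [b, a, b])) - nc_word (map (Pair j) [b, a, b]))"
      unfolding braid(1) nc_map_add[OF f] by (simp only: add_diff_add)
    also have "\<dots> \<in> fk_ideal n"
      by (intro add nc_map_Xs_prod) (use braid in auto)
    finally have "nc_map edge_gen r \<in> fk_ideal n"
      by (rule diff[rotated]) (use fk_braid[OF i] in simp)
    then show ?thesis using f by (simp add: fk_kernel_def braid(1) falg_add del: list.map)
  next
    case claw
    have i: "j \<in> {1..n}" "a \<in> {1..n}" "b \<in> {1..n}" "c \<in> {1..n}" "distinct [j, a, b, c]"
      using edgeD[OF claw(2)] edgeD[OF claw(3)] edgeD[OF claw(4)] claw(5) by auto
    have f: "ncprod (map (Xs j) [a, b, c, a]) \<in> falg E" "ncprod (map (Xs j) [b, c, a, b]) \<in> falg E"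
      "ncprod (map (Xs j) [c, a, b, c]) \<in> falg E"
      by (rule fX; use claw in simp)+
    have "nc_map edge_gen r - (nc_word (map (Pair j) [a, b, c, a]) + nc_word (map (Pair j) [b, c, a, b])
        + nc_word (map (Pair j) [c, a, b, c]))
      = (nc_map edge_gen (ncprod (map (Xs j) [a, b, c, a])) - nc_word (map (Pair j) [a, b, c, a]))
      + (nc_map edge_gen (ncprod (map (Xs j) [b, c, a, b])) - nc_word (map (Pair j) [b, c, a, b]))
      + (nc_map edge_gen (ncprod (map (Xs j) [c, a, b, c])) - nc_word (map (Pair j) [c, a, b, c]))"
      unfolding claw(1) nc_map_add[OF falg_add[OF f(1,2)] f(3)] nc_map_add[OF f(1,2)]
      by (simp only: add_diff_add)
    also have "\<dots> \<in> fk_ideal n"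
      by (intro add nc_map_Xs_prod) (use claw in auto)
    finally have "nc_map edge_gen r \<in> fk_ideal n"
      by (rule diff[rotated]) (use fk_claw[OF i] in simp)
    then show ?thesis using f by (simp add: fk_kernel_def claw(1) falg_add del: list.map)
  qed
qed

lemma nc_map_falg: "p \<in> falg E \<Longrightarrow> nc_map edge_gen p \<in> falg (fk_gens n)"
proof -
  assume p: "p \<in> falg E"
  have "nc_map edge_gen (\<Sum>w\<in>{w. p w \<noteq> 0}. nc_scale (p w) (nc_word w)) =
      (\<Sum>w\<in>{w. p w \<noteq> 0}. nc_scale (p w) (nc_word (map edge_gen w)))"
    by (rule nc_map_sum_words) (use p in \<open>auto simp: falg_def\<close>)
  moreover have "\<dots> \<in> falg (fk_gens n)"
  proof (intro nc.subspace_sum[OF falg_subspace] falg_scale falg_word)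
    fix w assume "w \<in> {w. p w \<noteq> 0}"
    then have "set w \<subseteq> E" using p by (simp add: falg_def)
    then show "set (map edge_gen w) \<subseteq> fk_gens n" using edge_gen_in by fastforce
  qed
  ultimately show ?thesis using nc_expand[of p] p by (simp add: falg_def)
qed

lemma ideal_subset_kernel: "ideal_gen E (graph_rels E) \<subseteq> fk_kernel n E"
proof
  fix p assume "p \<in> ideal_gen E (graph_rels E)"
  then show "p \<in> fk_kernel n E"
  proof induction
    case zero
    show ?case by (simp add: fk_kernel_def fk_ideal_def nc_map_zero ideal_gen.zero del: zero_fun_apply)
  next
    case (base r)
    then show ?case by (rule graph_rels_kernel)
  next
    case (add p q)
    then show ?case
      by (auto simp: fk_kernel_def nc_map_add falg_add fk_ideal_def intro: ideal_gen.add simp del: plus_fun_apply)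
  next
    case (lmul p q)
    then show ?case
      by (auto simp: fk_kernel_def nc_map_mul falg_mul fk_ideal_def nc_map_falg intro: ideal_gen.lmul)
  next
    case (rmul p q)
    then show ?case
      by (auto simp: fk_kernel_def nc_map_mul falg_mul fk_ideal_def nc_map_falg intro: ideal_gen.rmul)
  qed
qed

end

subsection \<open>The tree\<close>

definition dedge :: "nat \<Rightarrow> nat set" where
  "dedge k = {par k, k}"

lemma Dn_edges_eq: "4 \<le> n \<Longrightarrow> Dn_edges n = dedge ` {2..n}"
proof
  assume n: "4 \<le> n"
  have "{k, k + 1} \<in> dedge ` {2..n}" if "4 \<le> k" "k + 1 \<le> n" for k
    using that by (intro image_eqI[of _ _ "k + 1"]) (auto simp: dedge_def par_def)
  moreover have "{1, k} \<in> dedge ` {2..n}" if "k \<in> {2, 3, 4}" for k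
    using that n by (intro image_eqI[of _ _ k]) (auto simp: dedge_def par_def)
  ultimately show "Dn_edges n \<subseteq> dedge ` {2..n}" unfolding Dn_edges_def by blast
  show "dedge ` {2..n} \<subseteq> Dn_edges n"
  proof
    fix e assume "e \<in> dedge ` {2..n}"
    then obtain k where k: "e = dedge k" "2 \<le> k" "k \<le> n" by auto
    consider "k = 2" | "k = 3" | "k = 4" | "5 \<le> k" using k by linarith
    then show "e \<in> Dn_edges n"
    proof cases
      case 4
      then have "e = {k - 1, (k - 1) + 1}" "4 \<le> k - 1" "(k - 1) + 1 \<le> n"
        using k by (auto simp: dedge_def par_def)
      then show ?thesis unfolding Dn_edges_def by blast
    qed (use k in \<open>auto simp: dedge_def par_def Dn_edges_def\<close>)
  qed
qed

lemma par_less: "2 \<le> k \<Longrightarrow> 1 \<le> par k \<and> par k < k"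
  by (auto simp: par_def)

lemma graph_Dn: "4 \<le> n \<Longrightarrow> graph n (Dn_edges n)"
proof
  fix e assume "4 \<le> n" "e \<in> Dn_edges n"
  then obtain k where "e = {par k, k}" "2 \<le> k" "k \<le> n" by (auto simp: Dn_edges_eq dedge_def)
  then show "\<exists>i j. e = {i, j} \<and> i < j \<and> i \<in> {1..n} \<and> j \<in> {1..n}"
    using par_less[of k] by (intro exI[of _ "par k"] exI[of _ k]) auto
qed

lemma edge_gen_dedge: "2 \<le> k \<Longrightarrow> edge_gen (dedge k) = dgen k"
  using par_less[of k] by (simp add: dedge_def dgen_def edge_gen_def)

lemma disjoint_dedge:
  "2 \<le> x \<Longrightarrow> 2 \<le> y \<Longrightarrow> x \<noteq> y \<Longrightarrow> \<not> adj x y \<Longrightarrow> dedge x \<inter> dedge y = {}"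
  by (auto simp: dedge_def par_def adj_def split: if_splits)

lemma ideal_word_context:
  assumes "set u \<subseteq> E" "set v \<subseteq> E"
  shows "nc_word x \<in> ideal_gen E R \<Longrightarrow> nc_word (u @ x @ v) \<in> ideal_gen E R"
    and "nc_word x - nc_word y \<in> ideal_gen E R \<Longrightarrow> nc_word (u @ x @ v) - nc_word (u @ y @ v) \<in> ideal_gen E R"
    and "nc_word x + nc_scale c (nc_word y) \<in> ideal_gen E R \<Longrightarrow>
      nc_word (u @ x @ v) + nc_scale c (nc_word (u @ y @ v)) \<in> ideal_gen E R"
    and "nc_word x + nc_word y + nc_word z \<in> ideal_gen E R \<Longrightarrow>
      nc_word (u @ x @ v) + nc_word (u @ y @ v) + nc_word (u @ z @ v) \<in> ideal_gen E R"
  using ideal_gen_context[OF _ assms, where R = R]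
  by (fastforce simp: ncmul_words ncmul_add_left ncmul_add_right ncmul_diff_left ncmul_diff_right
      ncmul_scale_left ncmul_scale_right simp del: plus_fun_apply)+

text \<open>In each braid word the sign of the repeated letter squares to 1, so one sign per word
  remains and the first can be normalised to 1. The value of \<open>c\<close> is immaterial for
  membership in a subspace.\<close>

lemma (in graph) braid_word:
  assumes "{j, a} \<in> E" "{j, b} \<in> E" "a \<noteq> b"
  obtains c where
    "nc_word [{j, a}, {j, b}, {j, a}] + nc_scale c (nc_word [{j, b}, {j, a}, {j, b}]) \<in> ideal_gen E (graph_rels E)"
proof
  let ?w = "nc_word [{j, a}, {j, b}, {j, a}]" and ?w' = "nc_word [{j, b}, {j, a}, {j, b}]"
  have "ncprod [Xs j a, Xs j b, Xs j a] + ncprod [Xs j b, Xs j a, Xs j b] \<in> ideal_gen E (graph_rels E)"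
    by (rule ideal_gen.base) (use assms in \<open>auto simp: graph_rels_def simp del: plus_fun_apply\<close>)
  moreover have "ncprod [Xs j a, Xs j b, Xs j a] = nc_scale (sg j b) (nc_word [{j, a}, {j, b}, {j, a}])" for a b
    by (simp add: ncprod_def Xs_eq ncmul_scale_left ncmul_scale_right ncmul_words sg_def)
  ultimately have "nc_scale (sg j b) ?w + nc_scale (sg j a) ?w' \<in> ideal_gen E (graph_rels E)"
    by (simp only:)
  from ideal_gen_scale[OF this, of "sg j b"]
  show "?w + nc_scale (sg j a * sg j b) ?w' \<in> ideal_gen E (graph_rels E)"
    by (simp add: nc.scale_right_distrib sg_square mult.commute del: plus_fun_apply)
qed

locale Dn =
  fixes n :: nat
  assumes n: "4 \<le> n"
begin

abbreviation "E \<equiv> Dn_edges n"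
abbreviation "J \<equiv> ideal_gen E (graph_rels E)"

sublocale graph n E by (rule graph_Dn[OF n])

lemma set_map_dedge: "set w \<subseteq> {2..n} \<Longrightarrow> set (map dedge w) \<subseteq> E"
  using Dn_edges_eq[OF n] by auto

lemma dedge_in: "2 \<le> k \<Longrightarrow> k \<le> n \<Longrightarrow> dedge k \<in> E"
  using Dn_edges_eq[OF n] by auto

text \<open>A relation placed between words lies in \<open>J\<close>, hence in \<open>V\<close>, so
  one of its words is in \<open>V\<close> once the others are. The premise on letters restricts the
  predicate to words that name edges, where the relations are available.\<close>

lemma reduction_words:
  assumes V: "nc.subspace V" "J \<subseteq> V"
  shows "reduction (\<lambda>w. set w \<subseteq> {2..n} \<longrightarrow> nc_word (map dedge w) \<in> V)"
proof
  note ctx = ideal_word_context[OF set_map_dedge set_map_dedge]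
  show "set (u @ x # x # v) \<subseteq> {2..n} \<longrightarrow> nc_word (map dedge (u @ x # x # v)) \<in> V" for u v x
  proof
    assume a: "set (u @ x # x # v) \<subseteq> {2..n}"
    have "nc_word [dedge x, dedge x] \<in> J"
      by (rule ideal_gen.base) (use a dedge_in[of x] in \<open>auto simp: graph_rels_def nc_gens_mul\<close>)
    from ctx(1)[OF _ _ this, of u v] a V(2) show "nc_word (map dedge (u @ x # x # v)) \<in> V" by auto
  qed
  show "set (u @ x # y # v) \<subseteq> {2..n} \<longrightarrow> nc_word (map dedge (u @ x # y # v)) \<in> V"
    if "x \<noteq> y" "\<not> adj x y" "set (u @ y # x # v) \<subseteq> {2..n} \<longrightarrow> nc_word (map dedge (u @ y # x # v)) \<in> V" for u v x y
  proof
    assume a: "set (u @ x # y # v) \<subseteq> {2..n}"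
    have "nc_word [dedge x, dedge y] - nc_word [dedge y, dedge x] \<in> J"
      by (rule ideal_gen.base) (use a dedge_in[of x] dedge_in[of y] disjoint_dedge[of x y] that in
          \<open>auto simp: graph_rels_def nc_gens_mul\<close>)
    from ctx(2)[OF _ _ this, of u v] a V(2)
    have "nc_word (map dedge (u @ x # y # v)) - nc_word (map dedge (u @ y # x # v)) \<in> V" by auto
    from nc.subspace_add[OF V(1) this, of "nc_word (map dedge (u @ y # x # v))"] that(3) a
    show "nc_word (map dedge (u @ x # y # v)) \<in> V" by (auto simp del: plus_fun_apply)
  qed
  show "set (u @ x # y # x # v) \<subseteq> {2..n} \<longrightarrow> nc_word (map dedge (u @ x # y # x # v)) \<in> V"
    if adj: "adj x y" and prem: "set (u @ y # x # y # v) \<subseteq> {2..n} \<longrightarrow> nc_word (map dedge (u @ y # x # y # v)) \<in> V" for u v x y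
  proof
    assume a: "set (u @ x # y # x # v) \<subseteq> {2..n}"
    \<comment> \<open>The common vertex is 1 for two of the letters 2, 3, 4; otherwise it is the
      smaller letter, the parent of the larger.\<close>
    have "\<exists>j k l. dedge x = {j, k} \<and> dedge y = {j, l} \<and> k \<noteq> l"
    proof -
      consider "x \<noteq> y" "x \<in> {2..4}" "y \<in> {2..4}" | "4 \<le> x" "y = Suc x" | "4 \<le> y" "x = Suc y"
        using adj by (auto simp: adj_def)
      then show ?thesis
      proof cases
        case 1
        then show ?thesis by (intro exI[of _ 1] exI[of _ x] exI[of _ y]) (auto simp: dedge_def par_def)
      next
        case 2
        then show ?thesis using par_less[of x]
          by (intro exI[of _ x] exI[of _ "par x"] exI[of _ y]) (auto simp: dedge_def par_def)
      next
        case 3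
        then show ?thesis using par_less[of y]
          by (intro exI[of _ y] exI[of _ x] exI[of _ "par y"]) (auto simp: dedge_def par_def)
      qed
    qed
    then obtain j k l where jkl: "dedge x = {j, k}" "dedge y = {j, l}" "k \<noteq> l" by blast
    moreover have "dedge x \<in> E" "dedge y \<in> E" using a dedge_in by auto
    ultimately obtain c where
      "nc_word [dedge x, dedge y, dedge x] + nc_scale c (nc_word [dedge y, dedge x, dedge y]) \<in> J"
      using braid_word[of j k l] by metis
    from ctx(3)[OF _ _ this, of u v] a V(2)
    have "nc_word (map dedge (u @ x # y # x # v)) + nc_scale c (nc_word (map dedge (u @ y # x # y # v))) \<in> V"
      by (auto simp del: plus_fun_apply)
    moreover have "nc_scale c (nc_word (map dedge (u @ y # x # y # v))) \<in> V"
      by (rule nc.subspace_scale[OF V(1)]) (use prem a in auto)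
    ultimately show "nc_word (map dedge (u @ x # y # x # v)) \<in> V"
      using nc.subspace_diff[OF V(1)] by fastforce
  qed
  show "set (u @ 4 # x # y # 4 # v) \<subseteq> {2..n} \<longrightarrow> nc_word (map dedge (u @ 4 # x # y # 4 # v)) \<in> V"
    if xy: "{x, y} = {2, 3}"
      and 1: "set (u @ x # y # 4 # x # v) \<subseteq> {2..n} \<longrightarrow> nc_word (map dedge (u @ x # y # 4 # x # v)) \<in> V"
      and 2: "set (u @ y # 4 # x # y # v) \<subseteq> {2..n} \<longrightarrow> nc_word (map dedge (u @ y # 4 # x # y # v)) \<in> V" for u v x y
  proof
    assume a: "set (u @ 4 # x # y # 4 # v) \<subseteq> {2..n}"
    have xy': "x = 2 \<and> y = 3 \<or> x = 3 \<and> y = 2" using xy by (auto simp: doubleton_eq_iff)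
    \<comment> \<open>The centre 1 is the smallest index, so the claw at it carries no
      signs.\<close>
    have Xs: "Xs 1 k = nc_word [dedge k]" if "k \<in> {2, 3, 4}" for k
      using that by (auto simp: Xs_def dedge_def par_def nc_gen_def)
    have "ncprod [Xs 1 x, Xs 1 y, Xs 1 4, Xs 1 x] + ncprod [Xs 1 y, Xs 1 4, Xs 1 x, Xs 1 y]
        + ncprod [Xs 1 4, Xs 1 x, Xs 1 y, Xs 1 4] \<in> graph_rels E"
    proof -
      have "{1, x} \<in> E" "{1, y} \<in> E" "{1, 4} \<in> E" "distinct [x, y, 4]"
        using xy' dedge_in[of 2] dedge_in[of 3] dedge_in[of 4] n by (auto simp: dedge_def par_def)
      then show ?thesis unfolding graph_rels_def by blast
    qed
    then have "ncprod [Xs 1 x, Xs 1 y, Xs 1 4, Xs 1 x] + ncprod [Xs 1 y, Xs 1 4, Xs 1 x, Xs 1 y]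
        + ncprod [Xs 1 4, Xs 1 x, Xs 1 y, Xs 1 4] \<in> J" by (rule ideal_gen.base)
    moreover have "ncprod [Xs 1 p, Xs 1 q, Xs 1 r, Xs 1 s] = nc_word [dedge p, dedge q, dedge r, dedge s]"
      if "{p, q, r, s} \<subseteq> {2, 3, 4}" for p q r s
      using that by (simp add: Xs ncprod_def ncmul_words del: One_nat_def)
    ultimately have "nc_word [dedge x, dedge y, dedge 4, dedge x] + nc_word [dedge y, dedge 4, dedge x, dedge y]
        + nc_word [dedge 4, dedge x, dedge y, dedge 4] \<in> J"
      using xy' by (auto simp del: plus_fun_apply One_nat_def)
    from ctx(4)[OF _ _ this, of u v] a V(2)
    have "nc_word (map dedge (u @ x # y # 4 # x # v)) + nc_word (map dedge (u @ y # 4 # x # y # v))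
        + nc_word (map dedge (u @ 4 # x # y # 4 # v)) \<in> V"
      by (auto simp del: plus_fun_apply)
    moreover have "nc_word (map dedge (u @ x # y # 4 # x # v)) + nc_word (map dedge (u @ y # 4 # x # y # v)) \<in> V"
      by (rule nc.subspace_add[OF V(1)]) (use 1 2 a in auto)
    ultimately show "nc_word (map dedge (u @ 4 # x # y # 4 # v)) \<in> V"
      using nc.subspace_diff[OF V(1)] by fastforce
  qed
qed

text \<open>\<open>reduction_words\<close> is applied to the span plus \<open>J\<close>. Only basis
  words of the same length enter, as the graded count requires.\<close>

lemma word_reduce:
  assumes "set w \<subseteq> {2..n}"
  obtains x y where "nc_word (map dedge w) = x + y" "y \<in> J"
    "x \<in> nc.span ((\<lambda>b. nc_word (map dedge b)) ` {b \<in> basis_words n. length b = length w})"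
proof -
  let ?S = "nc.span ((\<lambda>b. nc_word (map dedge b)) ` {b \<in> basis_words n. length b = length w})"
  define V where "V = {x + y | x y. x \<in> ?S \<and> y \<in> J}"
  have V: "nc.subspace V" unfolding V_def
    by (rule nc.subspace_sums) (auto simp: ideal_gen_subspace)
  have "J \<subseteq> V" unfolding V_def using nc.span_zero by force
  then have "reduction (\<lambda>w. set w \<subseteq> {2..n} \<longrightarrow> nc_word (map dedge w) \<in> V)"
    using V by (intro reduction_words)
  then have "set w \<subseteq> {2..n} \<longrightarrow> nc_word (map dedge w) \<in> V"
  proof (rule basis_words_reduce[of _ n])
    fix b assume b: "b \<in> basis_words n" "length b = length w"
    then have "nc_word (map dedge b) \<in> ?S" by (intro nc.span_base) auto
    then have "nc_word (map dedge b) + 0 \<in> V" unfolding V_def using ideal_gen.zero by blast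
    then show "set b \<subseteq> {2..n} \<longrightarrow> nc_word (map dedge b) \<in> V" by (simp del: plus_fun_apply)
  qed (use assms in auto)
  then show ?thesis using that assms unfolding V_def by blast
qed

lemma map_edge_gen_dedge: "set b \<subseteq> {2..n} \<Longrightarrow> map edge_gen (map dedge b) = map dgen b"
  by (auto simp: edge_gen_dedge)

text \<open>Extending the coefficients by 0 reduces to the full basis; subsets are allowed so that a
  single degree can be treated.\<close>

lemma basis_sum_zero:
  assumes "B \<subseteq> basis_words n" "(\<Sum>b\<in>B. nc_scale (c b) (nc_word (map dgen b))) \<in> fk_ideal n" "b \<in> B"
  shows "c b = 0"
proof -
  define d where "d b = (if b \<in> B then c b else 0)" for b
  have "(\<Sum>b\<in>basis_words n. nc_scale (d b) (nc_word (map dgen b)))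
      = (\<Sum>b\<in>B. nc_scale (c b) (nc_word (map dgen b)))"
    using assms(1) finite_basis_words
    by (intro sum.mono_neutral_cong_right) (auto simp: d_def simp del: zero_fun_apply)
  with assms(2) fk_ideal_subset have "(\<Sum>b\<in>basis_words n. nc_scale (d b) (nc_word (map dgen b))) \<in> FK_ideal"
    by auto
  from basis_words_independent[OF this, of b] assms show ?thesis by (auto simp: d_def)
qed

text \<open>A kernel element is x + y with x in the span of the basis words and y in
  \<open>J\<close>. As \<open>J\<close> lies in the kernel, x maps into the ideal too, and
  independence forces x = 0.\<close>

lemma kernel_eq: "fk_kernel n E = J"
proof
  show "J \<subseteq> fk_kernel n E" by (rule ideal_subset_kernel)
  show "fk_kernel n E \<subseteq> J"
  proof
    fix p assume p: "p \<in> fk_kernel n E"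
    let ?g = "\<lambda>b. nc_word (map dedge b)"
    define V where "V = {x + y | x y. x \<in> nc.span (?g ` basis_words n) \<and> y \<in> J}"
    have "nc.subspace V" unfolding V_def
      by (rule nc.subspace_sums) (auto simp: ideal_gen_subspace)
    moreover have "{nc_word w | w. set w \<subseteq> E} \<subseteq> V"
    proof clarify
      fix w assume "set w \<subseteq> E"
      then have "w \<in> lists (dedge ` {2..n})" by (simp add: lists_eq_set Dn_edges_eq[OF n])
      then have "w \<in> map dedge ` lists {2..n}" by (simp only: lists_image)
      then obtain w' where w': "w = map dedge w'" "set w' \<subseteq> {2..n}" by auto
      obtain x y where xy: "nc_word (map dedge w') = x + y" "y \<in> J"
        "x \<in> nc.span (?g ` {b \<in> basis_words n. length b = length w'})"
        using word_reduce[OF w'(2)] .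
      have "nc.span (?g ` {b \<in> basis_words n. length b = length w'}) \<subseteq> nc.span (?g ` basis_words n)"
        by (rule nc.span_mono) auto
      then show "nc_word w \<in> V" unfolding V_def using xy w'(1) by blast
    qed
    ultimately have "falg E \<subseteq> V" unfolding falg_eq_span by (rule nc.span_minimal[rotated])
    then obtain x y where xy: "p = x + y" "x \<in> nc.span (?g ` basis_words n)" "y \<in> J"
      using p unfolding V_def fk_kernel_def by blast
    obtain c where c: "x = (\<Sum>b\<in>basis_words n. nc_scale (c b) (?g b))"
      using span_image_sum[OF finite_basis_words xy(2)] .
    have f: "set (map dedge b) \<subseteq> E" if "b \<in> basis_words n" for b
      using set_map_dedge[OF set_basis_words[OF that]] .
    have y: "y \<in> falg E" "nc_map edge_gen y \<in> fk_ideal n"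
      using ideal_subset_kernel xy(3) by (auto simp: fk_kernel_def)
    have x: "x \<in> falg E"
      unfolding c by (intro nc.subspace_sum[OF falg_subspace] falg_scale falg_word f)
    have "nc_map edge_gen x = nc_map edge_gen p - nc_map edge_gen y"
      unfolding xy(1) nc_map_add[OF x y(1)] by simp
    moreover have "nc_map edge_gen p - nc_map edge_gen y \<in> fk_ideal n"
      using p y(2) unfolding fk_kernel_def fk_ideal_def by (intro ideal_gen_diff) auto
    moreover have "nc_map edge_gen x = (\<Sum>b\<in>basis_words n. nc_scale (c b) (nc_word (map dgen b)))"
      unfolding c by (subst nc_map_sum_words[OF finite_basis_words f])
        (auto intro!: sum.cong simp: map_edge_gen_dedge[OF set_basis_words] simp del: map_map)
    ultimately have "(\<Sum>b\<in>basis_words n. nc_scale (c b) (nc_word (map dgen b))) \<in> fk_ideal n" by (simp only:)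
    then have "c b = 0" if "b \<in> basis_words n" for b using basis_sum_zero[of "basis_words n" c b] that by blast
    then have "x = (\<Sum>b\<in>basis_words n. 0)" unfolding c by (intro sum.cong) (simp_all del: zero_fun_apply)
    then have "x = 0" by (simp only: sum.neutral_const)
    then show "p \<in> J" using xy by (simp del: plus_fun_apply)
  qed
qed

text \<open>The basis words of length d span a complement of the ideal in degree d. Spanning is
  obtained in the free algebra on the edges and pushed forward by \<open>nc_map\<close>.\<close>

lemma hilbert_card: "hilbert_coeff n E d = card {b \<in> basis_words n. length b = d}"
proof -
  define Bd where "Bd = {b \<in> basis_words n. length b = d}"
  let ?g = "\<lambda>b. nc_word (map dgen b)" and ?e = "\<lambda>b. nc_word (map dedge b)"
  let ?G = "{nc_word (map edge_gen w) | w. set w \<subseteq> E \<and> length w = d}"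
  have fB: "finite Bd" using finite_basis_words by (simp add: Bd_def)
  have sB: "set b \<subseteq> {2..n}" if "b \<in> Bd" for b using that set_basis_words by (auto simp: Bd_def)
  have inj: "inj_on ?g Bd"
  proof (rule inj_onI)
    fix a b assume "a \<in> Bd" "b \<in> Bd" "?g a = ?g b"
    then have "map dgen a = map dgen b" by (metis nc_word_def zero_neq_one)
    moreover have "inj dgen" by (rule injI) (simp add: dgen_def)
    ultimately show "a = b" by (simp add: inj_map_eq_map)
  qed
  have zero: "c b = 0" if "(\<Sum>b\<in>Bd. nc_scale (c b) (?g b)) \<in> fk_ideal n" "b \<in> Bd" for c b
    using basis_sum_zero[OF _ that] by (auto simp: Bd_def)
  have finG: "finite ?G"
  proof -
    have "finite E" using Dn_edges_eq[OF n] by simp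
    then have "finite ((\<lambda>w. nc_word (map edge_gen w)) ` {w. set w \<subseteq> E \<and> length w = d})"
      by (intro finite_imageI finite_lists_length_eq)
    then show ?thesis by (simp add: image_Collect)
  qed
  have gW: "?g b \<in> nc.span ?G" if "b \<in> Bd" for b
  proof (rule nc.span_base, intro CollectI exI conjI)
    show "?g b = nc_word (map edge_gen (map dedge b))" using map_edge_gen_dedge[OF sB[OF that]] by (simp only:)
    show "set (map dedge b) \<subseteq> E" by (rule set_map_dedge[OF sB[OF that]])
    show "length (map dedge b) = d" using that by (simp add: Bd_def)
  qed
  define U where "U = EG_words E d \<inter> fk_ideal n"
  have W: "EG_words E d = nc.span ?G" by (simp add: EG_words_def)
  have subU: "nc.subspace U" unfolding U_def W fk_ideal_def
    by (rule nc.subspace_inter) (simp_all add: ideal_gen_subspace)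
  have "nc.dim (EG_words E d) - nc.dim U = card (?g ` Bd)"
  proof (rule dim_complement[OF subU _ W finG])
    show "U \<subseteq> EG_words E d" by (simp add: U_def)
    show "?g ` Bd \<subseteq> EG_words E d" unfolding W using gW by blast
    show "finite (?g ` Bd)" using fB by simp
    show "nc.independent (?g ` Bd)"
    proof (subst nc.dependent_finite)
      show "\<not> (\<exists>u. (\<exists>v\<in>?g ` Bd. u v \<noteq> 0) \<and> (\<Sum>v\<in>?g ` Bd. nc_scale (u v) v) = 0)"
      proof clarify
        fix u b assume b: "b \<in> Bd" "u (?g b) \<noteq> 0" and z: "(\<Sum>v\<in>?g ` Bd. nc_scale (u v) v) = 0"
        have "(\<Sum>b\<in>Bd. nc_scale (u (?g b)) (?g b)) = 0"
          using z unfolding sum.reindex[OF inj] comp_def .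
        then have "(\<Sum>b\<in>Bd. nc_scale (u (?g b)) (?g b)) \<in> fk_ideal n"
          unfolding fk_ideal_def by (simp only: ideal_gen.zero)
        from zero[of "\<lambda>b. u (?g b)", OF this b(1)] b(2) show False by simp
      qed
    qed (use fB in simp)
    show "nc.span (?g ` Bd) \<inter> U \<subseteq> {0}"
    proof
      fix x assume x: "x \<in> nc.span (?g ` Bd) \<inter> U"
      obtain c where c: "x = (\<Sum>b\<in>Bd. nc_scale (c b) (?g b))"
        using span_image_sum[OF fB] x by blast
      have "x \<in> fk_ideal n" using x by (simp add: U_def)
      then have "c b = 0" if "b \<in> Bd" for b using zero[of c b] c that by simp
      then have "x = (\<Sum>b\<in>Bd. 0)" unfolding c by (intro sum.cong) (simp_all del: zero_fun_apply)
      then show "x \<in> {0}" by (simp only: sum.neutral_const singleton_iff)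
    qed
    show "\<exists>x y. w = x + y \<and> x \<in> nc.span (?g ` Bd) \<and> y \<in> U" if "w \<in> EG_words E d" for w
    proof -
      define V where "V = {x + y | x y. x \<in> nc.span (?g ` Bd) \<and> y \<in> U}"
      have "nc.subspace V" unfolding V_def by (rule nc.subspace_sums) (auto simp: subU)
      moreover have "?G \<subseteq> V"
      proof clarify
        fix w assume w: "set w \<subseteq> E" "d = length w"
        then have "w \<in> lists (dedge ` {2..n})" by (simp add: lists_eq_set Dn_edges_eq[OF n])
        then have "w \<in> map dedge ` lists {2..n}" by (simp only: lists_image)
        then obtain w' where w': "w = map dedge w'" "set w' \<subseteq> {2..n}" by auto
        have "{b \<in> basis_words n. length b = length w'} = Bd" using w w' by (simp add: Bd_def)
        then obtain x y where xy: "nc_word (map dedge w') = x + y" "y \<in> J" "x \<in> nc.span (?e ` Bd)"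
          using word_reduce[OF w'(2)] by metis
        obtain c where c: "x = (\<Sum>b\<in>Bd. nc_scale (c b) (?e b))"
          using span_image_sum[OF fB xy(3)] .
        have f: "set (map dedge b) \<subseteq> E" if "b \<in> Bd" for b using set_map_dedge[OF sB[OF that]] .
        have y: "y \<in> falg E" "nc_map edge_gen y \<in> fk_ideal n"
          using ideal_subset_kernel xy(2) by (auto simp: fk_kernel_def)
        have x: "x \<in> falg E"
          unfolding c by (intro nc.subspace_sum[OF falg_subspace] falg_scale falg_word f)
        have mx: "nc_map edge_gen x = (\<Sum>b\<in>Bd. nc_scale (c b) (?g b))"
          unfolding c by (subst nc_map_sum_words[OF fB f])
            (auto intro!: sum.cong simp: map_edge_gen_dedge[OF sB] simp del: map_map)
        have sx: "nc_map edge_gen x \<in> nc.span (?g ` Bd)"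
          unfolding mx by (intro nc.span_sum nc.span_scale nc.span_base) auto
        have eq: "nc_word (map edge_gen w) = nc_map edge_gen x + nc_map edge_gen y"
          using nc_map_add[OF x y(1)] xy(1) w'(1) nc_map_word[of edge_gen w] by simp
        \<comment> \<open>That the remainder has degree d is read off from the other two terms of
          the decomposition.\<close>
        have "nc_map edge_gen y = nc_word (map edge_gen w) - nc_map edge_gen x" unfolding eq by simp
        moreover have "nc_word (map edge_gen w) \<in> nc.span ?G" using w by (intro nc.span_base) blast
        moreover have "nc_map edge_gen x \<in> nc.span ?G"
          unfolding mx by (intro nc.span_sum nc.span_scale gW)
        ultimately have "nc_map edge_gen y \<in> U" using y(2) nc.span_diff by (simp add: U_def W)
        then show "nc_word (map edge_gen w) \<in> V" unfolding V_def using eq sx by blast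
      qed
      ultimately have "EG_words E d \<subseteq> V" unfolding W by (rule nc.span_minimal[rotated])
      then show ?thesis using that unfolding V_def by blast
    qed
  qed
  then show ?thesis using card_image[OF inj]
    by (simp add: hilbert_coeff_def EG_dim_def U_def Bd_def)
qed

end

theorem mainTheorem16:
  fixes n :: nat
  assumes "n \<ge> 4"
  shows "fk_kernel n (Dn_edges n) = ideal_gen (Dn_edges n) (graph_rels (Dn_edges n))
    \<and> (\<forall>d. hilbert_coeff n (Dn_edges n) d =
          coeff (qint n * qint (n - 1) * (\<Prod>k\<in>{2..n - 2}. qint (2 * k))) d)"
proof (intro conjI allI)
  interpret Dn n by unfold_locales (rule assms)
  show "fk_kernel n (Dn_edges n) = ideal_gen (Dn_edges n) (graph_rels (Dn_edges n))"
    by (rule kernel_eq)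
  fix d
  have "coeff (qint n * qint (n - 1) * (\<Prod>k\<in>{2..n - 2}. qint (2 * k))) d
      = coeff (\<Sum>b\<in>basis_words n. monom 1 (length b)) d"
    using sum_basis_words[of n] assms by simp
  also have "\<dots> = (\<Sum>b\<in>basis_words n. if length b = d then 1 else 0)"
    unfolding coeff_sum coeff_monom ..
  also have "\<dots> = card {b \<in> basis_words n. length b = d}"
    using finite_basis_words by (simp add: sum.If_cases Int_def)
  finally show "hilbert_coeff n (Dn_edges n) d
      = coeff (qint n * qint (n - 1) * (\<Prod>k\<in>{2..n - 2}. qint (2 * k))) d"
    by (simp add: hilbert_card)
qed

end
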